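(* Consider the generalized eigenvalue problem: find $\lambda_h\in\mathbb{R}$ and $u_h\in V^1_h\setminus\{0\}$ such that $$\widetilde{\operatorname{curl}}_h\operatorname{curl}_hu_h=\lambda_h\big[(P^1_h)^*P^1_h+(I-P^1_h)^*(I-P^1_h)\big]u_h. \qquad (\ast)$$ For $\lambda_h\neq0$, problem $(\ast)$ has the same solutions $(\lambda_h,u_h)$ as the conforming eigenproblem $$\widetilde{\operatorname{curl}}^c_h\operatorname{curl}^c_hu_h=\lambda_hu_h,\qquad u_h\in V^{1,c}_h\setminus\{0\}.$$ For $\lambda_h=0$, the corresponding eigenspace is $$\ker\big(\widetilde{\operatorname{curl}}_h\operatorname{curl}_h\big)=\big(\operatorname{grad}V^{0,c}_h\overset{\perp}{\oplus}\mathcal{H}^1_h\big)\oplus(I-P^1_h)V^1_h,$$ where $\overset{\perp}{\oplus}$ denotes an $L^2$-orthogonal direct sum.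
   Context: $\langle\cdot,\cdot\rangle$ is the $L^2(\Omega)$ scalar product and $A^*$ denotes the $L^2$-adjoint of a linear operator $A$ between the finite-dimensional spaces below. Let $\Omega\subset\mathbb{R}^3$ be a domain decomposed in a partition of open subdomains $\Omega_k$, $k=1,\dots,K$, and set $V^0=H^1_0(\Omega)$, $V^1=H_0(\operatorname{curl};\Omega)$, $V^2=H_0(\operatorname{div};\Omega)$. For each $k$ let $V^0_h(\Omega_k)\subset H^1(\Omega_k)$, $V^1_h(\Omega_k)\subset H(\operatorname{curl};\Omega_k)$, $V^2_h(\Omega_k)\subset H(\operatorname{div};\Omega_k)$ be finite-dimensional spaces (no boundary conditions) with $\operatorname{grad}V^0_h(\Omega_k)\subset V^1_h(\Omega_k)$ and $\operatorname{curl}V^1_h(\Omega_k)\subset V^2_h(\Omega_k)$. The broken spaces are $$V^\ell_h:=\{v\in L^2(\Omega): v|_{\Omega_k}\in V^\ell_h(\Omega_k),\ k=1,\dots,K\}$$ (vector-valued for $\ell=1,2$), and the conforming spaces are $V^{\ell,c}_h:=V^\ell_h\cap V^\ell$; one has $\operatorname{grad}V^{0,c}_h\subset V^{1,c}_h$, $\operatorname{curl}V^{1,c}_h\subset V^{2,c}_h$. The conforming projection $P^1_h:V^1_h\to V^1_h$ is a linear projection with range $V^{1,c}_h$. Operators: - $\operatorname{curl}_h:=\operatorname{curl}P^1_h:V^1_h\to V^2_h$, and $\widetilde{\operatorname{curl}}_h:V^2_h\to V^1_h$ is its $L^2$-adjoint. - $\operatorname{curl}^c_h:=\operatorname{curl}|_{V^{1,c}_h}:V^{1,c}_h\to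 V^{2,c}_h$, and $\widetilde{\operatorname{curl}}^c_h:V^{2,c}_h\to V^{1,c}_h$ is its $L^2$-adjoint. Discrete harmonic 1-forms: $\mathcal{H}^1_h:=\{v\in V^{1,c}_h:\operatorname{curl}v=0\text{ and }\langle\operatorname{grad}q,v\rangle=0\ \forall q\in V^{0,c}_h\}$. *)

theory Defs
  imports "HOL-Analysis.Analysis"
begin

section \<open>The space \<open>L\<^sup>2\<close>\<close>

text \<open>
  \<open>'a L2\<close> is the space of square-integrable \<open>'a\<close>-valued functions on \<open>\<real>\<^sup>3\<close> modulo equality
  almost everywhere (\<open>'a = real\<close> for scalar fields, \<open>'a = real^3\<close> for vector fields).
  For measurable \<open>S\<close>, the space \<open>L\<^sup>2(S)\<close> is identified, through extension by zero, with the
  closed subspace \<open>L2_on S\<close> of classes that vanish almost everywhere outside \<open>S\<close>; the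
  \<open>L\<^sup>2(S)\<close> scalar product is then the inner product of the type.
\<close>

definition square_integrable :: "(real^3 \<Rightarrow> 'a::euclidean_space) \<Rightarrow> bool" where
  "square_integrable f \<longleftrightarrow>
     f \<in> borel_measurable lebesgue \<and> integrable lebesgue (\<lambda>x. (norm (f x))\<^sup>2)"

definition l2_rel :: "(real^3 \<Rightarrow> 'a::euclidean_space) \<Rightarrow> (real^3 \<Rightarrow> 'a) \<Rightarrow> bool" where
  "l2_rel f g \<longleftrightarrow> square_integrable f \<and> square_integrable g \<and> (AE x in lebesgue. f x = g x)"

lemma square_integrable_0: "square_integrable (\<lambda>x. 0)"
  by (simp add: square_integrable_def)

lemma square_integrable_add:
  assumes "square_integrable f" "square_integrable g"
  shows "square_integrable (\<lambda>x. f x + g x)"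
proof -
  have m: "f \<in> borel_measurable lebesgue" "g \<in> borel_measurable lebesgue"
    using assms by (auto simp: square_integrable_def)
  have i: "integrable lebesgue (\<lambda>x. 2 * (norm (f x))\<^sup>2 + 2 * (norm (g x))\<^sup>2)"
    using assms by (auto simp: square_integrable_def)
  have b: "(norm (u + v))\<^sup>2 \<le> 2 * (norm u)\<^sup>2 + 2 * (norm v)\<^sup>2" for u v :: 'a
  proof -
    have "(norm (u + v))\<^sup>2 \<le> (norm u + norm v)\<^sup>2"
      by (intro power_mono norm_triangle_ineq) auto
    moreover have "0 \<le> (norm u - norm v)\<^sup>2" by simp
    ultimately show ?thesis by (simp add: power2_sum power2_diff)
  qed
  have "integrable lebesgue (\<lambda>x. (norm (f x + g x))\<^sup>2)"
    by (rule Bochner_Integration.integrable_bound[OF i])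
       (use m b in \<open>auto intro!: borel_measurable_add\<close>)
  then show ?thesis using m by (simp add: square_integrable_def borel_measurable_add)
qed

lemma square_integrable_scaleR:
  assumes "square_integrable f"
  shows "square_integrable (\<lambda>x. c *\<^sub>R f x)"
  using assms by (auto simp: square_integrable_def power_mult_distrib)

lemma integrable_inner_L2:
  assumes "square_integrable f" "square_integrable g"
  shows "integrable lebesgue (\<lambda>x. f x \<bullet> g x)"
proof -
  have m: "f \<in> borel_measurable lebesgue" "g \<in> borel_measurable lebesgue"
    using assms by (auto simp: square_integrable_def)
  have i: "integrable lebesgue (\<lambda>x. (norm (f x))\<^sup>2 + (norm (g x))\<^sup>2)"
    using assms by (auto simp: square_integrable_def)
  have b: "\<bar>u \<bullet> v\<bar> \<le> (norm u)\<^sup>2 + (norm v)\<^sup>2" for u v :: 'a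
  proof -
    have "\<bar>u \<bullet> v\<bar> \<le> norm u * norm v" by (rule Cauchy_Schwarz_ineq2)
    moreover have "0 \<le> (norm u - norm v)\<^sup>2" "0 \<le> norm u * norm v" by simp_all
    ultimately show ?thesis by (simp add: power2_diff)
  qed
  show ?thesis
    by (rule Bochner_Integration.integrable_bound[OF i])
       (use m b in \<open>auto intro!: borel_measurable_inner\<close>)
qed

quotient_type (overloaded) 'a L2 = "real^3 \<Rightarrow> 'a::euclidean_space" / partial: l2_rel
proof (rule part_equivpI)
  show "\<exists>f::real^3 \<Rightarrow> 'a. l2_rel f f"
    using square_integrable_0 by (auto simp: l2_rel_def)
  show "symp (l2_rel :: (real^3 \<Rightarrow> 'a) \<Rightarrow> _)"
    by (auto simp: l2_rel_def intro!: sympI)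
  show "transp (l2_rel :: (real^3 \<Rightarrow> 'a) \<Rightarrow> _)"
    by (rule transpI) (auto simp: l2_rel_def)
qed

instantiation L2 :: (euclidean_space) real_inner
begin

lift_definition zero_L2 :: "'a L2" is "\<lambda>x. 0"
  by (simp add: l2_rel_def square_integrable_0)

lift_definition plus_L2 :: "'a L2 \<Rightarrow> 'a L2 \<Rightarrow> 'a L2" is "\<lambda>f g x. f x + g x"
  by (auto simp: l2_rel_def square_integrable_add)

lift_definition scaleR_L2 :: "real \<Rightarrow> 'a L2 \<Rightarrow> 'a L2" is "\<lambda>c f x. c *\<^sub>R f x"
  by (auto simp: l2_rel_def square_integrable_scaleR)

lift_definition inner_L2 :: "'a L2 \<Rightarrow> 'a L2 \<Rightarrow> real"
  is "\<lambda>f g. integral\<^sup>L lebesgue (\<lambda>x. f x \<bullet> g x)"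
proof -
  fix f f' g g' :: "real^3 \<Rightarrow> 'a"
  assume *: "l2_rel f f'" "l2_rel g g'"
  show "integral\<^sup>L lebesgue (\<lambda>x. f x \<bullet> g x) = integral\<^sup>L lebesgue (\<lambda>x. f' x \<bullet> g' x)"
    by (rule integral_cong_AE) (use * in \<open>auto simp: l2_rel_def square_integrable_def\<close>)
qed

definition uminus_L2 :: "'a L2 \<Rightarrow> 'a L2" where "uminus_L2 u = (-1) *\<^sub>R u"
definition minus_L2 :: "'a L2 \<Rightarrow> 'a L2 \<Rightarrow> 'a L2" where "minus_L2 u v = u + (- v)"
definition norm_L2 :: "'a L2 \<Rightarrow> real" where "norm_L2 u = sqrt (u \<bullet> u)"
definition dist_L2 :: "'a L2 \<Rightarrow> 'a L2 \<Rightarrow> real" where "dist_L2 u v = norm (u - v)"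
definition sgn_L2 :: "'a L2 \<Rightarrow> 'a L2" where "sgn_L2 u = inverse (norm u) *\<^sub>R u"
definition uniformity_L2 :: "('a L2 \<times> 'a L2) filter" where
  "uniformity_L2 = (INF e\<in>{0<..}. principal {(x, y). dist x y < e})"
definition open_L2 :: "'a L2 set \<Rightarrow> bool" where
  "open_L2 U \<longleftrightarrow> (\<forall>x\<in>U. eventually (\<lambda>(x', y). x' = x \<longrightarrow> y \<in> U) uniformity)"

instance
proof
  fix a b :: real and u v w :: "'a L2" and U :: "'a L2 set"
  show "u + v + w = u + (v + w)"
    by transfer (auto simp: l2_rel_def add.assoc intro!: square_integrable_add)
  show "u + v = v + u"
    by transfer (auto simp: l2_rel_def add.commute intro!: square_integrable_add)
  show "0 + u = u"
    by transfer (auto simp: l2_rel_def)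
  show "- u + u = 0"
    unfolding uminus_L2_def
    by transfer (auto simp: l2_rel_def square_integrable_0)
  show "u - v = u + - v"
    by (rule minus_L2_def)
  show "a *\<^sub>R (u + v) = a *\<^sub>R u + a *\<^sub>R v"
    by transfer (auto simp: l2_rel_def scaleR_add_right
        intro!: square_integrable_add square_integrable_scaleR)
  show "(a + b) *\<^sub>R u = a *\<^sub>R u + b *\<^sub>R u"
    by transfer (auto simp: l2_rel_def scaleR_add_left
        intro!: square_integrable_add square_integrable_scaleR)
  show "a *\<^sub>R b *\<^sub>R u = (a * b) *\<^sub>R u"
    by transfer (auto simp: l2_rel_def intro!: square_integrable_scaleR)
  show "1 *\<^sub>R u = u"
    by transfer (auto simp: l2_rel_def)
  show "dist u v = norm (u - v)"
    by (rule dist_L2_def)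
  show "sgn u = inverse (norm u) *\<^sub>R u"
    by (rule sgn_L2_def)
  show "uniformity = (INF e\<in>{0<..}. principal {(x, y :: 'a L2). dist x y < e})"
    by (rule uniformity_L2_def)
  show "open U \<longleftrightarrow> (\<forall>x\<in>U. eventually (\<lambda>(x', y). x' = x \<longrightarrow> y \<in> U) uniformity)"
    by (rule open_L2_def)
  show "u \<bullet> v = v \<bullet> u"
    by transfer (simp add: inner_commute)
  show "(u + v) \<bullet> w = u \<bullet> w + v \<bullet> w"
    by transfer (auto simp: l2_rel_def inner_add_left integrable_inner_L2)
  show "(a *\<^sub>R u) \<bullet> v = a * (u \<bullet> v)"
    by transfer auto
  show "0 \<le> u \<bullet> u"
    by transfer auto
  show "u \<bullet> u = 0 \<longleftrightarrow> u = 0"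
  proof transfer
    fix f :: "real^3 \<Rightarrow> 'a"
    assume "l2_rel f f"
    then have f: "square_integrable f" by (simp add: l2_rel_def)
    have "integral\<^sup>L lebesgue (\<lambda>x. f x \<bullet> f x) = 0 \<longleftrightarrow> (AE x in lebesgue. f x \<bullet> f x = 0)"
      by (rule integral_nonneg_eq_0_iff_AE) (auto intro: integrable_inner_L2[OF f f])
    then show "integral\<^sup>L lebesgue (\<lambda>x. f x \<bullet> f x) = 0 \<longleftrightarrow> l2_rel f (\<lambda>x. 0)"
      using f by (simp add: l2_rel_def square_integrable_0)
  qed
  show "norm u = sqrt (u \<bullet> u)"
    by (rule norm_L2_def)
qed

end

text \<open>\<open>to_L2\<close> is meaningful for square-integrable functions only, so the restriction
  \<open>restrict_L2 S\<close> is meaningful for measurable \<open>S\<close> (below, \<open>S\<close> is always open).\<close>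

definition to_L2 :: "(real^3 \<Rightarrow> 'a::euclidean_space) \<Rightarrow> 'a L2" where
  "to_L2 f = abs_L2 f"

text \<open>The restriction \<open>u|\<^sub>S\<close>, extended by zero.\<close>

definition restrict_L2 :: "(real^3) set \<Rightarrow> 'a::euclidean_space L2 \<Rightarrow> 'a L2" where
  "restrict_L2 S u = to_L2 (\<lambda>x. indicator S x *\<^sub>R rep_L2 u x)"

definition L2_on :: "(real^3) set \<Rightarrow> 'a::euclidean_space L2 set" where
  "L2_on S = {u. restrict_L2 S u = u}"


section \<open>Test functions and classical derivatives\<close>

definition pderiv_dir :: "3 \<Rightarrow> (real^3 \<Rightarrow> 'a::euclidean_space) \<Rightarrow> real^3 \<Rightarrow> 'a" where
  "pderiv_dir i f x = frechet_derivative f (at x) (axis i 1)"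

primrec Ck :: "nat \<Rightarrow> (real^3 \<Rightarrow> 'a::euclidean_space) \<Rightarrow> bool" where
  "Ck 0 f \<longleftrightarrow> continuous_on UNIV f"
| "Ck (Suc n) f \<longleftrightarrow> (\<forall>x. f differentiable (at x)) \<and> (\<forall>i. Ck n (pderiv_dir i f))"

definition test_function :: "(real^3) set \<Rightarrow> (real^3 \<Rightarrow> 'a::euclidean_space) \<Rightarrow> bool" where
  "test_function S \<phi> \<longleftrightarrow> (\<forall>n. Ck n \<phi>) \<and>
     compact (closure {x. \<phi> x \<noteq> 0}) \<and> closure {x. \<phi> x \<noteq> 0} \<subseteq> S"

definition grad_cl :: "(real^3 \<Rightarrow> real) \<Rightarrow> real^3 \<Rightarrow> real^3" where
  "grad_cl f x = (\<chi> i. pderiv_dir i f x)"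

definition curl_cl :: "(real^3 \<Rightarrow> real^3) \<Rightarrow> real^3 \<Rightarrow> real^3" where
  "curl_cl F x = vector
     [pderiv_dir 2 F x $ 3 - pderiv_dir 3 F x $ 2,
      pderiv_dir 3 F x $ 1 - pderiv_dir 1 F x $ 3,
      pderiv_dir 1 F x $ 2 - pderiv_dir 2 F x $ 1]"

definition div_cl :: "(real^3 \<Rightarrow> real^3) \<Rightarrow> real^3 \<Rightarrow> real" where
  "div_cl F x = (\<Sum>i\<in>UNIV. pderiv_dir i F x $ i)"


section \<open>Weak derivatives and the spaces \<open>H\<^sup>1\<close>, \<open>H(curl)\<close>, \<open>H(div)\<close>\<close>

text \<open>Distributional derivatives on the open set \<open>S\<close>: the value lies in \<open>L\<^sup>2(S)\<close> and only
  test functions with support in \<open>S\<close> are used.\<close>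

definition has_weak_grad :: "(real^3) set \<Rightarrow> real L2 \<Rightarrow> (real^3) L2 \<Rightarrow> bool" where
  "has_weak_grad S u g \<longleftrightarrow> g \<in> L2_on S \<and>
     (\<forall>\<phi>. test_function S \<phi> \<longrightarrow> g \<bullet> to_L2 \<phi> = - (u \<bullet> to_L2 (div_cl \<phi>)))"

definition has_weak_curl :: "(real^3) set \<Rightarrow> (real^3) L2 \<Rightarrow> (real^3) L2 \<Rightarrow> bool" where
  "has_weak_curl S v w \<longleftrightarrow> w \<in> L2_on S \<and>
     (\<forall>\<phi>. test_function S \<phi> \<longrightarrow> w \<bullet> to_L2 \<phi> = v \<bullet> to_L2 (curl_cl \<phi>))"

definition has_weak_div :: "(real^3) set \<Rightarrow> (real^3) L2 \<Rightarrow> real L2 \<Rightarrow> bool" where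
  "has_weak_div S v d \<longleftrightarrow> d \<in> L2_on S \<and>
     (\<forall>\<phi>. test_function S \<phi> \<longrightarrow> d \<bullet> to_L2 \<phi> = - (v \<bullet> to_L2 (grad_cl \<phi>)))"

definition weak_grad :: "(real^3) set \<Rightarrow> real L2 \<Rightarrow> (real^3) L2" where
  "weak_grad S u = (THE g. has_weak_grad S u g)"

definition weak_curl :: "(real^3) set \<Rightarrow> (real^3) L2 \<Rightarrow> (real^3) L2" where
  "weak_curl S v = (THE w. has_weak_curl S v w)"

definition weak_div :: "(real^3) set \<Rightarrow> (real^3) L2 \<Rightarrow> real L2" where
  "weak_div S v = (THE d. has_weak_div S v d)"

definition H1 :: "(real^3) set \<Rightarrow> real L2 set" where
  "H1 S = {u \<in> L2_on S. \<exists>g. has_weak_grad S u g}"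

definition Hcurl :: "(real^3) set \<Rightarrow> (real^3) L2 set" where
  "Hcurl S = {v \<in> L2_on S. \<exists>w. has_weak_curl S v w}"

definition Hdiv :: "(real^3) set \<Rightarrow> (real^3) L2 set" where
  "Hdiv S = {v \<in> L2_on S. \<exists>d. has_weak_div S v d}"

text \<open>Homogeneous boundary conditions: closures of the test functions in the graph norms.\<close>

definition H1_0 :: "(real^3) set \<Rightarrow> real L2 set" where
  "H1_0 S = {u \<in> H1 S. \<exists>\<phi>. (\<forall>n. test_function S (\<phi> n)) \<and>
     (\<lambda>n. to_L2 (\<phi> n)) \<longlonglongrightarrow> u \<and> (\<lambda>n. to_L2 (grad_cl (\<phi> n))) \<longlonglongrightarrow> weak_grad S u}"

definition Hcurl_0 :: "(real^3) set \<Rightarrow> (real^3) L2 set" where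
  "Hcurl_0 S = {v \<in> Hcurl S. \<exists>\<phi>. (\<forall>n. test_function S (\<phi> n)) \<and>
     (\<lambda>n. to_L2 (\<phi> n)) \<longlonglongrightarrow> v \<and> (\<lambda>n. to_L2 (curl_cl (\<phi> n))) \<longlonglongrightarrow> weak_curl S v}"

definition Hdiv_0 :: "(real^3) set \<Rightarrow> (real^3) L2 set" where
  "Hdiv_0 S = {v \<in> Hdiv S. \<exists>\<phi>. (\<forall>n. test_function S (\<phi> n)) \<and>
     (\<lambda>n. to_L2 (\<phi> n)) \<longlonglongrightarrow> v \<and> (\<lambda>n. to_L2 (div_cl (\<phi> n))) \<longlonglongrightarrow> weak_div S v}"


section \<open>Broken spaces\<close>

definition is_domain :: "(real^3) set \<Rightarrow> bool" where
  "is_domain S \<longleftrightarrow> open S \<and> connected S \<and> S \<noteq> {}"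

text \<open>The open subdomains cover \<open>\<Omega>\<close> up to the interfaces, a Lebesgue null set; this also yields
  \<open>closure \<Omega> = (\<Union>k. closure (\<Omega>k k))\<close>.\<close>

definition subdomain_partition :: "(real^3) set \<Rightarrow> nat \<Rightarrow> (nat \<Rightarrow> (real^3) set) \<Rightarrow> bool" where
  "subdomain_partition \<Omega> K \<Omega>k \<longleftrightarrow>
     (\<forall>k\<in>{1..K}. is_domain (\<Omega>k k) \<and> \<Omega>k k \<subseteq> \<Omega>) \<and>
     disjoint_family_on \<Omega>k {1..K} \<and>
     negligible (\<Omega> - (\<Union>k\<in>{1..K}. \<Omega>k k))"

definition fin_dim_subspace :: "'v::real_vector set \<Rightarrow> bool" where
  "fin_dim_subspace V \<longleftrightarrow> subspace V \<and> (\<exists>B. finite B \<and> V \<subseteq> span B)"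

definition broken_space ::
  "(real^3) set \<Rightarrow> nat \<Rightarrow> (nat \<Rightarrow> (real^3) set) \<Rightarrow> (nat \<Rightarrow> 'a::euclidean_space L2 set) \<Rightarrow> 'a L2 set"
  where
  "broken_space \<Omega> K \<Omega>k Vloc =
     {v \<in> L2_on \<Omega>. \<forall>k\<in>{1..K}. restrict_L2 (\<Omega>k k) v \<in> Vloc k}"


section \<open>Linear algebra on subspaces\<close>

definition linear_projection_on :: "'v::real_vector set \<Rightarrow> 'v set \<Rightarrow> ('v \<Rightarrow> 'v) \<Rightarrow> bool" where
  "linear_projection_on V W P \<longleftrightarrow>
     (\<forall>x\<in>V. \<forall>y\<in>V. P (x + y) = P x + P y) \<and>
     (\<forall>c. \<forall>x\<in>V. P (c *\<^sub>R x) = c *\<^sub>R P x) \<and>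
     W \<subseteq> V \<and> P ` V = W \<and> (\<forall>x\<in>V. P (P x) = P x)"

text \<open>The adjoint \<open>A\<^sup>* : Y \<rightarrow> X\<close> of \<open>A : X \<rightarrow> Y\<close>, for subspaces \<open>X\<close> and \<open>Y\<close>.
  It depends on \<open>X\<close>, and is left unspecified outside \<open>Y\<close>.\<close>

definition adjoint_on ::
  "'v::real_inner set \<Rightarrow> 'w::real_inner set \<Rightarrow> ('v \<Rightarrow> 'w) \<Rightarrow> 'w \<Rightarrow> 'v" where
  "adjoint_on X Y A = (\<lambda>y\<in>Y. THE z. z \<in> X \<and> (\<forall>x\<in>X. z \<bullet> x = y \<bullet> A x))"

definition is_direct_sum :: "'v::real_vector set \<Rightarrow> 'v set \<Rightarrow> 'v set \<Rightarrow> bool" where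
  "is_direct_sum W A B \<longleftrightarrow>
     subspace A \<and> subspace B \<and> A \<inter> B = {0} \<and> W = {a + b | a b. a \<in> A \<and> b \<in> B}"

definition is_orthogonal_direct_sum :: "'v::real_inner set \<Rightarrow> 'v set \<Rightarrow> 'v set \<Rightarrow> bool" where
  "is_orthogonal_direct_sum W A B \<longleftrightarrow> is_direct_sum W A B \<and> (\<forall>a\<in>A. \<forall>b\<in>B. a \<bullet> b = 0)"

end

theory Submission
  imports Defs
begin

text \<open>
  Write \<open>P\<close> for the conforming projection and \<open>A\<close> for the weak curl on its range. Tested against \<open>v\<close>,
  the eigenproblem reads \<open>\<langle>A P u, A P v\<rangle> = \<lambda> (\<langle>P u, P v\<rangle> + \<langle>(I - P) u, (I - P) v\<rangle>)\<close>. For \<open>\<lambda> \<noteq> 0\<close> the choice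
  \<open>v = (I - P) u\<close> forces \<open>P u = u\<close>, and testing with conforming \<open>v\<close> gives the conforming problem.
  For \<open>\<lambda> = 0\<close> the choice \<open>v = u\<close> gives \<open>A P u = 0\<close>, so the kernel is \<open>ker A \<oplus> ran (I - P)\<close>, and the
  orthogonal complement in \<open>ker A\<close> of the gradients consists of the discrete harmonic forms.

  The analytic input is that weak derivatives are unique (test functions separate points of \<open>L\<^sup>2\<close>,
  since smooth bumps converge to indicators of boxes) and that gradients are curl free and curls are
  divergence free, which the symmetry of second derivatives of test functions gives directly.
\<close>

section \<open>Calculus of smooth functions and first-order operators\<close>

text \<open>\<open>weak_grad\<close>, \<open>weak_curl\<close> and \<open>adjoint_on\<close> are
  definite descriptions, so even their linearity has to be earned: existence and uniqueness of the
  described object come before every use. For weak derivatives uniqueness is the separation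
  property; for adjoints existence is a Riesz theorem on finite-dimensional subspaces, and the
  finite dimension of the broken space rests on the subdomains filling \<Omega> up to a null set.
  The piecewise half holds because weak derivatives commute with restriction to a subdomain. The
  boundary half holds because derivatives of the approximating test functions are again test
  functions, and the next operator annihilates them, so they approximate the image in the next graph
  norm. For nonzero \<lambda> the term (I - P)*(I - P) enforces conformity: P annihilates v = (I -
  P) u, so the left side vanishes while the right side is \<lambda> times the squared norm of (I -
  P) u.\<close>

lemma pderiv_dir_eq:
  assumes "(f has_derivative f') (at x)"
  shows "pderiv_dir i f x = f' (axis i 1)"
  using frechet_derivative_at[OF assms] by (simp add: pderiv_dir_def)

lemma pderiv_dir_bounded_linear:
  assumes "bounded_linear L" "f differentiable (at x)"
  shows "pderiv_dir i (\<lambda>x. L (f x)) x = L (pderiv_dir i f x)"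
  using pderiv_dir_eq[OF bounded_linear.has_derivative[OF assms(1) frechet_derivative_works[THEN iffD1, OF assms(2)]]]
  by (simp add: pderiv_dir_def)

lemma pderiv_dir_add:
  assumes "f differentiable (at x)" "g differentiable (at x)"
  shows "pderiv_dir i (\<lambda>x. f x + g x) x = pderiv_dir i f x + pderiv_dir i g x"
  using pderiv_dir_eq[OF has_derivative_add[OF assms[unfolded frechet_derivative_works]]]
  by (simp add: pderiv_dir_def)

lemma pderiv_dir_scaleR_fun:
  fixes a :: "real^3 \<Rightarrow> real"
  assumes "a differentiable (at x)" "g differentiable (at x)"
  shows "pderiv_dir i (\<lambda>x. a x *\<^sub>R g x) x = a x *\<^sub>R pderiv_dir i g x + pderiv_dir i a x *\<^sub>R g x"
  using pderiv_dir_eq[OF has_derivative_scaleR[OF assms[unfolded frechet_derivative_works]]]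
  by (simp add: pderiv_dir_def)

lemma Ck_SucD: "Ck (Suc n) f \<Longrightarrow> Ck n f"
proof (induction n arbitrary: f)
  case 0
  then show ?case
    by (simp add: continuous_at_imp_continuous_on differentiable_imp_continuous_within)
next
  case (Suc n)
  then show ?case by simp
qed

lemma Ck_bounded_linear:
  assumes "bounded_linear L" "Ck n f"
  shows "Ck n (\<lambda>x. L (f x))"
  using assms(2)
proof (induction n arbitrary: f)
  case 0
  then show ?case
    by (simp add: linear_continuous_on_compose bounded_linear.continuous_on[OF assms(1)])
next
  case (Suc n)
  have d: "f differentiable (at x)" for x using Suc.prems by simp
  have "pderiv_dir i (\<lambda>x. L (f x)) = (\<lambda>x. L (pderiv_dir i f x))" for i
    using d by (simp add: fun_eq_iff pderiv_dir_bounded_linear assms(1))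
  then show ?case
    using Suc differentiable_compose[OF bounded_linear_imp_differentiable[OF assms(1)] d]
    by simp
qed

lemma Ck_add:
  assumes "Ck n f" "Ck n g"
  shows "Ck n (\<lambda>x. f x + g x)"
  using assms
proof (induction n arbitrary: f g)
  case 0
  then show ?case by (simp add: continuous_on_add)
next
  case (Suc n)
  then have "pderiv_dir i (\<lambda>x. f x + g x) = (\<lambda>x. pderiv_dir i f x + pderiv_dir i g x)" for i
    by (simp add: fun_eq_iff pderiv_dir_add)
  then show ?case using Suc by simp
qed

lemma Ck_const: "Ck n (\<lambda>x. c)"
proof (induction n arbitrary: c)
  case (Suc n)
  have "pderiv_dir i (\<lambda>x. c) = (\<lambda>x. 0)" for i
    by (simp add: fun_eq_iff pderiv_dir_def)
  then show ?case using Suc by simp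
qed simp

lemma Ck_sum:
  assumes "\<And>i. i \<in> I \<Longrightarrow> Ck n (f i)"
  shows "Ck n (\<lambda>x. \<Sum>i\<in>I. f i x)"
  using assms by (induction I rule: infinite_finite_induct) (simp_all add: Ck_const Ck_add)

lemma Ck_scaleR_fun:
  fixes a :: "real^3 \<Rightarrow> real"
  assumes "Ck n a" "Ck n g"
  shows "Ck n (\<lambda>x. a x *\<^sub>R g x)"
  using assms
proof (induction n arbitrary: a g)
  case 0
  then show ?case by (simp add: continuous_on_scaleR)
next
  case (Suc n)
  then have "pderiv_dir i (\<lambda>x. a x *\<^sub>R g x) = (\<lambda>x. a x *\<^sub>R pderiv_dir i g x + pderiv_dir i a x *\<^sub>R g x)" for i
    by (simp add: fun_eq_iff pderiv_dir_scaleR_fun)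
  \<comment> \<open>The Leibniz rule leaves one factor undifferentiated in each term, so the
    induction hypothesis is applied to pairs such as \<open>a\<close> and
    \<open>pderiv_dir i g\<close>.\<close>
  moreover have "Ck n a" "Ck n g" using Suc.prems Ck_SucD by blast+
  ultimately show ?case using Suc by (simp add: Ck_add differentiable_scaleR)
qed

lemma Ck_prod:
  fixes f :: "'i \<Rightarrow> real^3 \<Rightarrow> real"
  assumes "\<And>i. i \<in> I \<Longrightarrow> Ck n (f i)"
  shows "Ck n (\<lambda>x. \<Prod>i\<in>I. f i x)"
  using assms
proof (induction I rule: infinite_finite_induct)
  case (insert i I)
  then show ?case using Ck_scaleR_fun[of n "f i" "\<lambda>x. \<Prod>i\<in>I. f i x"] by simp
qed (simp_all add: Ck_const)

lemma has_derivative_direction: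
  assumes "f differentiable (at (x + s *\<^sub>R axis i 1))"
  shows "((\<lambda>s. f (x + s *\<^sub>R axis i 1)) has_vector_derivative pderiv_dir i f (x + s *\<^sub>R axis i 1)) (at s)"
proof -
  have "((\<lambda>s. x + s *\<^sub>R axis i 1) has_derivative (\<lambda>h. h *\<^sub>R axis i 1)) (at s)"
    by (auto intro!: derivative_eq_intros)
  from diff_chain_at[OF this frechet_derivative_works[THEN iffD1, OF assms]]
  show ?thesis
    by (simp add: has_vector_derivative_def o_def pderiv_dir_def
        linear_cmul[OF linear_frechet_derivative[OF assms]])
qed

text \<open>Mean value theorem twice: along \<open>i\<close> for the increment of \<open>f\<close>
  in direction \<open>j\<close>, then along \<open>j\<close> for the resulting derivative. The
  second difference is symmetric in \<open>i\<close> and \<open>j\<close> while the right side is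
  not; this asymmetry is what the next lemma exploits.\<close>

lemma second_difference_eq_mixed_pderiv:
  fixes f :: "real^3 \<Rightarrow> real"
  assumes f: "Ck 2 f" and h: "0 < h"
  obtains s t where "0 < s" "s < h" "0 < t" "t < h"
    "f (x + h *\<^sub>R axis i 1 + h *\<^sub>R axis j 1) - f (x + h *\<^sub>R axis i 1) - f (x + h *\<^sub>R axis j 1) + f x
      = h\<^sup>2 * pderiv_dir j (pderiv_dir i f) (x + s *\<^sub>R axis i 1 + t *\<^sub>R axis j 1)"
proof -
  let ?i = "axis i 1 :: real^3" and ?j = "axis j 1 :: real^3"
  have d: "f differentiable (at y)" "pderiv_dir k f differentiable (at y)" for y k
    using f by (simp_all add: numeral_2_eq_2)
  let ?\<phi> = "\<lambda>s. f ((x + h *\<^sub>R ?j) + s *\<^sub>R ?i) - f (x + s *\<^sub>R ?i)"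
  let ?\<phi>' = "\<lambda>s. pderiv_dir i f ((x + h *\<^sub>R ?j) + s *\<^sub>R ?i) - pderiv_dir i f (x + s *\<^sub>R ?i)"
  have D: "(?\<phi> has_real_derivative ?\<phi>' s) (at s)" for s
    using has_vector_derivative_diff[OF has_derivative_direction[OF d(1)] has_derivative_direction[OF d(1)]]
    by (simp add: has_real_derivative_iff_has_vector_derivative)
  obtain s where s: "0 < s" "s < h" and se: "?\<phi> h - ?\<phi> 0 = (h - 0) * ?\<phi>' s"
    using MVT2[of 0 h ?\<phi> ?\<phi>'] h D by blast
  let ?\<psi> = "\<lambda>t. pderiv_dir i f ((x + s *\<^sub>R ?i) + t *\<^sub>R ?j)"
  have E: "(?\<psi> has_real_derivative pderiv_dir j (pderiv_dir i f) ((x + s *\<^sub>R ?i) + t *\<^sub>R ?j)) (at t)" for t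
    using has_derivative_direction[OF d(2)]
    by (simp add: has_real_derivative_iff_has_vector_derivative)
  obtain t where t: "0 < t" "t < h"
    "?\<psi> h - ?\<psi> 0 = (h - 0) * pderiv_dir j (pderiv_dir i f) ((x + s *\<^sub>R ?i) + t *\<^sub>R ?j)"
    using MVT2[of 0 h ?\<psi> "\<lambda>t. pderiv_dir j (pderiv_dir i f) ((x + s *\<^sub>R ?i) + t *\<^sub>R ?j)"] h E by blast
  show thesis
  proof (rule that[OF s t(1,2)])
    have "?\<phi>' s = ?\<psi> h - ?\<psi> 0" by (simp add: algebra_simps)
    then have "?\<phi> h - ?\<phi> 0 = h * (h * pderiv_dir j (pderiv_dir i f) ((x + s *\<^sub>R ?i) + t *\<^sub>R ?j))"
      using se t(3) by simp
    then show "f (x + h *\<^sub>R ?i + h *\<^sub>R ?j) - f (x + h *\<^sub>R ?i) - f (x + h *\<^sub>R ?j) + f x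
      = h\<^sup>2 * pderiv_dir j (pderiv_dir i f) (x + s *\<^sub>R ?i + t *\<^sub>R ?j)"
      by (simp add: power2_eq_square algebra_simps)
  qed
qed

lemma pderiv_dir_commute_real:
  fixes f :: "real^3 \<Rightarrow> real"
  assumes f: "Ck 2 f"
  shows "pderiv_dir i (pderiv_dir j f) x = pderiv_dir j (pderiv_dir i f) x"
proof -
  define \<Delta> where "\<Delta> h = (f (x + h *\<^sub>R axis i 1 + h *\<^sub>R axis j 1) - f (x + h *\<^sub>R axis i 1)
      - f (x + h *\<^sub>R axis j 1) + f x) / h\<^sup>2" for h
  \<comment> \<open>The quotient \<Delta> does not see the order of \<open>i\<close> and
    \<open>j\<close>, so one argument computes its limit for both orders, and uniqueness of limits
    equates the two mixed derivatives.\<close>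
  have lim: "(\<lambda>n. \<Delta> (inverse (real (Suc n)))) \<longlonglongrightarrow> pderiv_dir l (pderiv_dir k f) x"
    if kl: "k = i \<and> l = j \<or> k = j \<and> l = i" for k l
  proof -
    have "\<exists>s t. 0 < s \<and> s < h \<and> 0 < t \<and> t < h \<and>
        \<Delta> h = pderiv_dir l (pderiv_dir k f) (x + s *\<^sub>R axis k 1 + t *\<^sub>R axis l 1)" if h: "0 < h" for h
    proof -
      obtain s t where st: "0 < s" "s < h" "0 < t" "t < h"
        "f (x + h *\<^sub>R axis k 1 + h *\<^sub>R axis l 1) - f (x + h *\<^sub>R axis k 1) - f (x + h *\<^sub>R axis l 1) + f x
          = h\<^sup>2 * pderiv_dir l (pderiv_dir k f) (x + s *\<^sub>R axis k 1 + t *\<^sub>R axis l 1)"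
        by (rule second_difference_eq_mixed_pderiv[OF f h])
      have "\<Delta> h = (f (x + h *\<^sub>R axis k 1 + h *\<^sub>R axis l 1) - f (x + h *\<^sub>R axis k 1)
          - f (x + h *\<^sub>R axis l 1) + f x) / h\<^sup>2"
        using kl by (auto simp: \<Delta>_def algebra_simps)
      also have "\<dots> = pderiv_dir l (pderiv_dir k f) (x + s *\<^sub>R axis k 1 + t *\<^sub>R axis l 1)"
        unfolding st(5) using h by simp
      finally show ?thesis using st by blast
    qed
    then have "\<forall>n. \<exists>s t. 0 < s \<and> s < inverse (real (Suc n)) \<and> 0 < t \<and> t < inverse (real (Suc n)) \<and>
        \<Delta> (inverse (real (Suc n))) = pderiv_dir l (pderiv_dir k f) (x + s *\<^sub>R axis k 1 + t *\<^sub>R axis l 1)"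
      by simp
    then obtain s t where st: "\<And>n. 0 < s n \<and> s n < inverse (real (Suc n))"
      "\<And>n. 0 < t n \<and> t n < inverse (real (Suc n))"
      and e: "\<And>n. \<Delta> (inverse (real (Suc n))) = pderiv_dir l (pderiv_dir k f) (x + s n *\<^sub>R axis k 1 + t n *\<^sub>R axis l 1)"
      by metis
    have "s \<longlonglongrightarrow> 0" "t \<longlonglongrightarrow> 0"
      by (rule real_tendsto_sandwich[OF _ _ tendsto_const LIMSEQ_inverse_real_of_nat];
          use st in \<open>auto intro!: always_eventually less_imp_le\<close>)+
    then have "(\<lambda>n. x + s n *\<^sub>R axis k 1 + t n *\<^sub>R axis l 1) \<longlonglongrightarrow> x + 0 *\<^sub>R axis k 1 + 0 *\<^sub>R axis l 1"
      by (intro tendsto_intros)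
    moreover have "isCont (pderiv_dir l (pderiv_dir k f)) x"
      using f by (simp add: numeral_2_eq_2 continuous_on_eq_continuous_at)
    ultimately show ?thesis
      unfolding e using isCont_tendsto_compose[of x "pderiv_dir l (pderiv_dir k f)"] by simp
  qed
  show ?thesis
    by (rule LIMSEQ_unique[OF lim lim]) auto
qed

text \<open>The mean value theorem is available for real values only, hence the passage to
  components.\<close>

lemma pderiv_dir_commute:
  assumes f: "Ck 2 f"
  shows "pderiv_dir i (pderiv_dir j f) x = pderiv_dir j (pderiv_dir i f) x"
proof (rule euclidean_eqI)
  fix b :: 'a
  have L: "bounded_linear (\<lambda>v. v \<bullet> b)" by (rule bounded_linear_inner_left)
  have d: "f differentiable (at y)" "pderiv_dir k f differentiable (at y)" for y k
    using f by (simp_all add: numeral_2_eq_2)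
  have "pderiv_dir k (\<lambda>x. f x \<bullet> b) = (\<lambda>x. pderiv_dir k f x \<bullet> b)" for k
    using d by (simp add: fun_eq_iff pderiv_dir_bounded_linear[OF L])
  then have "pderiv_dir k (pderiv_dir l f) x \<bullet> b = pderiv_dir k (pderiv_dir l (\<lambda>x. f x \<bullet> b)) x" for k l
    using d by (simp add: pderiv_dir_bounded_linear[OF L])
  then show "pderiv_dir i (pderiv_dir j f) x \<bullet> b = pderiv_dir j (pderiv_dir i f) x \<bullet> b"
    using pderiv_dir_commute_real[OF Ck_bounded_linear[OF L f]] by simp
qed


section \<open>Constant-coefficient first-order operators and their symbols\<close>

definition smooth :: "(real^3 \<Rightarrow> 'a::euclidean_space) \<Rightarrow> bool" where
  "smooth f \<longleftrightarrow> (\<forall>n. Ck n f)"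

lemma smooth_pderiv_dir: "smooth f \<Longrightarrow> smooth (pderiv_dir i f)"
  unfolding smooth_def by (metis Ck.simps(2))

lemma smooth_imp_differentiable: "smooth f \<Longrightarrow> f differentiable (at x)"
  unfolding smooth_def by (metis Ck.simps(2))

lemma smooth_imp_continuous_on: "smooth f \<Longrightarrow> continuous_on UNIV f"
  unfolding smooth_def by (metis Ck.simps(1))

text \<open>Here \<open>L i\<close> is the matrix coefficient of the i-th partial derivative.
  Gradient, curl and divergence differ only in \<open>L\<close>, so linearity, locality and the
  complex property are proved once for all three.\<close>

definition first_order_op ::
  "(3 \<Rightarrow> 'a::euclidean_space \<Rightarrow> 'b::euclidean_space) \<Rightarrow> (real^3 \<Rightarrow> 'a) \<Rightarrow> real^3 \<Rightarrow> 'b" where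
  "first_order_op L \<phi> x = (\<Sum>i\<in>UNIV. L i (pderiv_dir i \<phi> x))"

lemma smooth_first_order_op:
  assumes L: "\<And>i. bounded_linear (L i)" and "smooth \<phi>"
  shows "smooth (first_order_op L \<phi>)"
  using smooth_pderiv_dir[OF assms(2)]
  by (auto simp: smooth_def first_order_op_def[abs_def] intro!: Ck_sum Ck_bounded_linear[OF L])

lemma first_order_op_add:
  assumes L: "\<And>i. bounded_linear (L i)" and "smooth \<phi>" "smooth \<psi>"
  shows "first_order_op L (\<lambda>x. \<phi> x + \<psi> x) = (\<lambda>x. first_order_op L \<phi> x + first_order_op L \<psi> x)"
  using assms(2,3)
  by (simp add: fun_eq_iff first_order_op_def pderiv_dir_add smooth_imp_differentiable
      bounded_linear.linear[OF L, THEN linear_add] sum.distrib)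

lemma first_order_op_scaleR:
  assumes L: "\<And>i. bounded_linear (L i)" and "smooth \<phi>"
  shows "first_order_op L (\<lambda>x. c *\<^sub>R \<phi> x) = (\<lambda>x. c *\<^sub>R first_order_op L \<phi> x)"
  using assms(2)
  by (simp add: fun_eq_iff first_order_op_def smooth_imp_differentiable
      pderiv_dir_bounded_linear[OF bounded_linear_scaleR_right]
      bounded_linear.linear[OF L, THEN linear_cmul] scaleR_sum_right)

text \<open>Symmetry of second derivatives makes the double sum cancel against its transpose.\<close>

lemma first_order_op_comp_eq_0:
  fixes \<phi> :: "real^3 \<Rightarrow> 'a::euclidean_space"
  assumes L: "\<And>i. bounded_linear (L i)" and M: "\<And>i. bounded_linear (M i)" and \<phi>: "smooth \<phi>"
    and anti: "\<And>i j v. L i (M j v) = - L j (M i v)"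
  shows "first_order_op L (first_order_op M \<phi>) = (\<lambda>x. 0)"
proof
  fix x
  let ?d = "\<lambda>i j. pderiv_dir i (pderiv_dir j \<phi>) x"
  have d: "pderiv_dir j \<phi> differentiable (at x)" for j
    using \<phi> by (simp add: smooth_imp_differentiable smooth_pderiv_dir)
  have "((\<lambda>x. M j (pderiv_dir j \<phi> x)) has_derivative
      (\<lambda>h. M j (frechet_derivative (pderiv_dir j \<phi>) (at x) h))) (at x)" for j
    using bounded_linear.has_derivative[OF M] d frechet_derivative_works by blast
  then have "((first_order_op M \<phi>) has_derivative
      (\<lambda>h. \<Sum>j\<in>UNIV. M j (frechet_derivative (pderiv_dir j \<phi>) (at x) h))) (at x)"
    unfolding first_order_op_def[abs_def] by (rule has_derivative_sum)
  then have "pderiv_dir i (first_order_op M \<phi>) x = (\<Sum>j\<in>UNIV. M j (?d i j))" for i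
    by (simp add: pderiv_dir_eq) (simp add: pderiv_dir_def)
  then have e: "first_order_op L (first_order_op M \<phi>) x = (\<Sum>i\<in>UNIV. \<Sum>j\<in>UNIV. L i (M j (?d i j)))"
    by (simp add: first_order_op_def bounded_linear.linear[OF L, THEN linear_sum])
  also have "\<dots> = (\<Sum>i\<in>UNIV. \<Sum>j\<in>UNIV. L j (M i (?d j i)))"
    by (rule sum.swap)
  also have "\<dots> = (\<Sum>i\<in>UNIV. \<Sum>j\<in>UNIV. - L i (M j (?d i j)))"
    using \<phi> pderiv_dir_commute[of \<phi>] anti by (intro sum.cong refl) (metis smooth_def)
  also have "\<dots> = - first_order_op L (first_order_op M \<phi>) x"
    unfolding e by (simp add: sum_negf)
  finally have "first_order_op L (first_order_op M \<phi>) x + first_order_op L (first_order_op M \<phi>) x = 0"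
    by (rule eq_neg_iff_add_eq_0[THEN iffD1])
  then show "first_order_op L (first_order_op M \<phi>) x = 0"
    by (simp flip: scaleR_2)
qed

text \<open>Differential operators are local: off the closed support the function vanishes on a
  neighbourhood, so its derivative is zero there.\<close>

lemma first_order_op_nonzero_subset:
  assumes L: "\<And>i. bounded_linear (L i)"
  shows "closure {x. first_order_op L \<phi> x \<noteq> 0} \<subseteq> closure {x. \<phi> x \<noteq> 0}"
proof (rule closure_minimal)
  show "{x. first_order_op L \<phi> x \<noteq> 0} \<subseteq> closure {x. \<phi> x \<noteq> 0}"
  proof (rule subsetI, rule ccontr)
    fix x assume x: "x \<in> {x. first_order_op L \<phi> x \<noteq> 0}" "x \<notin> closure {x. \<phi> x \<noteq> 0}"
    have "(\<phi> has_derivative (\<lambda>h. 0)) (at x)"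
      by (rule has_derivative_transform_within_open[where f = "\<lambda>x. 0" and s = "- closure {x. \<phi> x \<noteq> 0}"])
        (use x closure_subset[of "{x. \<phi> x \<noteq> 0}"] in \<open>auto simp: open_Compl\<close>)
    then have "first_order_op L \<phi> x = 0"
      by (simp add: first_order_op_def pderiv_dir_eq bounded_linear.linear[OF L, THEN linear_0])
    then show False using x by simp
  qed
qed simp

lemma compact_closure_subset:
  fixes K :: "'a::t2_space set"
  assumes "compact K" "closure A \<subseteq> K"
  shows "compact (closure A)"
  using compact_Int_closed[OF assms(1) closed_closure[of A]] assms(2) by (simp add: Int_absorb1)

lemma test_function_first_order_op:
  assumes L: "\<And>i. bounded_linear (L i)" and \<phi>: "test_function S \<phi>"
  shows "test_function S (first_order_op L \<phi>)"
proof -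
  have "smooth (first_order_op L \<phi>)"
    using \<phi> by (intro smooth_first_order_op L) (simp add: test_function_def smooth_def)
  moreover have sub: "closure {x. first_order_op L \<phi> x \<noteq> 0} \<subseteq> closure {x. \<phi> x \<noteq> 0}"
    by (rule first_order_op_nonzero_subset[OF L])
  moreover have "compact (closure {x. first_order_op L \<phi> x \<noteq> 0})"
    using \<phi> sub unfolding test_function_def by (blast intro: compact_closure_subset)
  ultimately show ?thesis
    using \<phi> unfolding test_function_def smooth_def by blast
qed

definition grad_symbol :: "3 \<Rightarrow> real \<Rightarrow> real^3" where
  "grad_symbol i a = a *\<^sub>R axis i 1"

text \<open>The curl is the formal cross product of nabla with the field, that is, the sum over i of
  the unit vector e_i crossed with the i-th partial derivative.\<close>

definition curl_symbol :: "3 \<Rightarrow> real^3 \<Rightarrow> real^3" where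
  "curl_symbol i v = cross3 (axis i 1) v"

definition div_symbol :: "3 \<Rightarrow> real^3 \<Rightarrow> real" where
  "div_symbol i v = v $ i"

lemma bounded_linear_symbol:
  "bounded_linear (grad_symbol i)" "bounded_linear (curl_symbol i)" "bounded_linear (div_symbol i)"
  unfolding grad_symbol_def[abs_def] curl_symbol_def[abs_def] div_symbol_def[abs_def]
  by (auto intro: bounded_linear_intros linear_conv_bounded_linear[THEN iffD1]
      simp: linear_iff cross_add_right cross_mult_right)

lemma grad_cl_eq: "grad_cl = first_order_op grad_symbol"
  by (auto simp: fun_eq_iff vec_eq_iff grad_cl_def first_order_op_def grad_symbol_def axis_def
      if_distrib sum.delta cong: if_cong)

lemma curl_cl_eq: "curl_cl = first_order_op curl_symbol"
proof (intro ext)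
  fix F x
  show "curl_cl F x = first_order_op curl_symbol F x"
    unfolding curl_cl_def first_order_op_def sum_3
    by (simp add: vec_eq_iff[where 'b=3] forall_3 curl_symbol_def cross3_def axis_def)
qed

lemma div_cl_eq: "div_cl = first_order_op div_symbol"
  by (simp add: fun_eq_iff div_cl_def first_order_op_def div_symbol_def)

text \<open>The cross product of e_i and e_j is antisymmetric, and in the next lemma the triple
  product of e_i, e_j and v alternates in i and j. These are "curl grad = 0" and "div curl = 0" at
  the level of symbols, in the shape of the hypothesis \<open>anti\<close> of
  \<open>first_order_op_comp_eq_0\<close>.\<close>

lemma curl_symbol_grad_symbol: "curl_symbol i (grad_symbol j a) = - curl_symbol j (grad_symbol i a)"
  by (simp add: curl_symbol_def grad_symbol_def cross_mult_right cross_skew[of "axis j 1"])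

lemma div_symbol_curl_symbol: "div_symbol i (curl_symbol j v) = - div_symbol j (curl_symbol i v)"
  using exhaust_3[of i] exhaust_3[of j]
  by (auto simp: div_symbol_def curl_symbol_def cross3_def axis_def)

section \<open>Square-integrable classes and restriction\<close>

lemma to_L2_eq_iff:
  assumes "square_integrable f" "square_integrable g"
  shows "to_L2 f = to_L2 g \<longleftrightarrow> (AE x in lebesgue. f x = g x)"
  using assms Quotient3_rel[OF Quotient3_L2, of f g] by (simp add: to_L2_def l2_rel_def)

lemma square_integrable_rep_L2: "square_integrable (rep_L2 u)"
  using Quotient3_rep_reflp[OF Quotient3_L2] by (simp add: l2_rel_def)

lemma to_L2_rep_L2 [simp]: "to_L2 (rep_L2 u) = u"
  using Quotient3_abs_rep[OF Quotient3_L2] by (simp add: to_L2_def)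

lemma L2_cases:
  obtains f where "square_integrable f" "u = to_L2 f"
  using square_integrable_rep_L2 to_L2_rep_L2 by metis

lemma to_L2_add:
  assumes "square_integrable f" "square_integrable g"
  shows "to_L2 (\<lambda>x. f x + g x) = to_L2 f + to_L2 g"
  using assms by (simp add: to_L2_def plus_L2.abs_eq l2_rel_def)

lemma to_L2_scaleR:
  assumes "square_integrable f"
  shows "to_L2 (\<lambda>x. c *\<^sub>R f x) = c *\<^sub>R to_L2 f"
  using assms by (simp add: to_L2_def scaleR_L2.abs_eq l2_rel_def)

lemma to_L2_0: "to_L2 (\<lambda>x. 0) = 0"
  by (simp add: to_L2_def zero_L2_def)

lemma to_L2_uminus:
  assumes "square_integrable f"
  shows "to_L2 (\<lambda>x. - f x) = - to_L2 f"
  using to_L2_scaleR[OF assms, of "-1"] by simp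

lemma square_integrable_sum:
  assumes "\<And>i. i \<in> I \<Longrightarrow> square_integrable (f i)"
  shows "square_integrable (\<lambda>x. \<Sum>i\<in>I. f i x)"
  using assms
  by (induction I rule: infinite_finite_induct) (simp_all add: square_integrable_0 square_integrable_add)

lemma to_L2_sum:
  assumes "\<And>i. i \<in> I \<Longrightarrow> square_integrable (f i)"
  shows "to_L2 (\<lambda>x. \<Sum>i\<in>I. f i x) = (\<Sum>i\<in>I. to_L2 (f i))"
  using assms
  by (induction I rule: infinite_finite_induct) (simp_all add: to_L2_0 to_L2_add square_integrable_sum)

lemma inner_to_L2:
  assumes "square_integrable f" "square_integrable g"
  shows "to_L2 f \<bullet> to_L2 g = integral\<^sup>L lebesgue (\<lambda>x. f x \<bullet> g x)"
  using assms by (simp add: to_L2_def inner_L2.abs_eq l2_rel_def)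

lemma square_integrable_indicator:
  assumes "S \<in> sets lebesgue" "square_integrable f"
  shows "square_integrable (\<lambda>x. indicator S x *\<^sub>R f x)"
proof -
  have [measurable]: "f \<in> borel_measurable lebesgue" "S \<in> sets lebesgue"
    using assms by (auto simp: square_integrable_def)
  have "integrable lebesgue (\<lambda>x. indicator S x *\<^sub>R (norm (f x))\<^sup>2)"
    using assms by (intro integrable_mult_indicator) (auto simp: square_integrable_def)
  moreover have "(\<lambda>x. (norm (indicat_real S x *\<^sub>R f x))\<^sup>2) = (\<lambda>x. indicator S x *\<^sub>R (norm (f x))\<^sup>2)"
    by (auto simp: indicator_def fun_eq_iff)
  ultimately show ?thesis by (simp add: square_integrable_def)
qed

text \<open>\<open>restrict_L2\<close> is defined through the chosen representative
  \<open>rep_L2\<close>; changing it on a null set changes nothing, so any representative may be cut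
  off instead.\<close>

lemma restrict_L2_to_L2:
  assumes S: "S \<in> sets lebesgue" and f: "square_integrable f"
  shows "restrict_L2 S (to_L2 f) = to_L2 (\<lambda>x. indicator S x *\<^sub>R f x)"
proof -
  have "AE x in lebesgue. rep_L2 (to_L2 f) x = f x"
    using to_L2_eq_iff[OF square_integrable_rep_L2 f, of "to_L2 f"] by simp
  then show ?thesis
    unfolding restrict_L2_def
    by (subst to_L2_eq_iff) (auto intro!: square_integrable_indicator S f square_integrable_rep_L2)
qed

lemma restrict_L2_add:
  assumes "S \<in> sets lebesgue"
  shows "restrict_L2 S (u + v) = restrict_L2 S u + restrict_L2 S v"
proof -
  obtain f g where "square_integrable f" "u = to_L2 f" "square_integrable g" "v = to_L2 g"
    by (meson L2_cases)
  then show ?thesis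
    using assms
    by (simp add: restrict_L2_to_L2 square_integrable_add square_integrable_indicator
        scaleR_add_right flip: to_L2_add)
qed

lemma restrict_L2_scaleR:
  assumes "S \<in> sets lebesgue"
  shows "restrict_L2 S (c *\<^sub>R u) = c *\<^sub>R restrict_L2 S u"
proof -
  obtain f where "square_integrable f" "u = to_L2 f"
    by (meson L2_cases)
  then show ?thesis
    using assms
    by (simp add: restrict_L2_to_L2 square_integrable_scaleR square_integrable_indicator
        mult.commute flip: to_L2_scaleR)
qed

lemma linear_restrict_L2: "S \<in> sets lebesgue \<Longrightarrow> linear (restrict_L2 S)"
  by (simp add: linear_iff restrict_L2_add restrict_L2_scaleR)

lemma restrict_L2_restrict_L2:
  assumes "S \<in> sets lebesgue" "T \<in> sets lebesgue"
  shows "restrict_L2 S (restrict_L2 T u) = restrict_L2 (S \<inter> T) u"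
proof -
  obtain f where "square_integrable f" "u = to_L2 f"
    by (meson L2_cases)
  then show ?thesis
    using assms
    by (simp add: restrict_L2_to_L2 square_integrable_indicator indicator_inter_arith)
qed

text \<open>Restriction is a self-adjoint cutoff, so it can be moved onto a test function, where it
  acts as the identity.\<close>

lemma inner_restrict_L2:
  assumes "S \<in> sets lebesgue"
  shows "restrict_L2 S u \<bullet> v = u \<bullet> restrict_L2 S v"
proof -
  obtain f g where "square_integrable f" "u = to_L2 f" "square_integrable g" "v = to_L2 g"
    by (meson L2_cases)
  then show ?thesis
    using assms by (simp add: restrict_L2_to_L2 inner_to_L2 square_integrable_indicator)
qed

lemma subspace_L2_on: "S \<in> sets lebesgue \<Longrightarrow> subspace (L2_on S)"
  by (auto simp: subspace_def L2_on_def restrict_L2_add restrict_L2_scaleR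
      linear_0[OF linear_restrict_L2])

lemma restrict_L2_in_L2_on: "S \<in> sets lebesgue \<Longrightarrow> restrict_L2 S u \<in> L2_on S"
  by (simp add: L2_on_def restrict_L2_restrict_L2)

lemma continuous_compact_support_square_integrable:
  fixes f :: "real^3 \<Rightarrow> 'a::euclidean_space"
  assumes f: "continuous_on UNIV f" and c: "compact (closure {x. f x \<noteq> 0})"
  shows "square_integrable f"
proof -
  let ?C = "closure {x. f x \<noteq> 0}"
  have z: "f x = 0" if "x \<notin> ?C" for x
    using that closure_subset[of "{x. f x \<noteq> 0}"] by blast
  have "continuous_on ?C (\<lambda>x. (norm (f x))\<^sup>2)"
    by (intro continuous_intros continuous_on_subset[OF f]) simp
  then have "integrable lborel (\<lambda>x. indicator ?C x *\<^sub>R (norm (f x))\<^sup>2)"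
    by (rule borel_integrable_compact[OF c])
  moreover have "(\<lambda>x. indicator ?C x *\<^sub>R (norm (f x))\<^sup>2) = (\<lambda>x. (norm (f x))\<^sup>2)"
  proof
    fix x
    show "indicator ?C x *\<^sub>R (norm (f x))\<^sup>2 = (norm (f x))\<^sup>2"
      using z[of x] by (cases "x \<in> ?C") simp_all
  qed
  ultimately have "integrable lborel (\<lambda>x. (norm (f x))\<^sup>2)"
    by (simp only:)
  moreover have "f \<in> borel_measurable borel"
    by (rule borel_measurable_continuous_onI[OF f])
  ultimately show ?thesis
    by (simp add: square_integrable_def integrable_completion measurable_completion)
qed

lemma test_function_imp_smooth: "test_function S \<phi> \<Longrightarrow> smooth \<phi>"
  by (simp add: test_function_def smooth_def)

lemma test_function_square_integrable: "test_function S \<phi> \<Longrightarrow> square_integrable \<phi>"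
  using continuous_compact_support_square_integrable[OF smooth_imp_continuous_on[OF test_function_imp_smooth]]
  by (auto simp: test_function_def)

lemma test_function_mono: "test_function S \<phi> \<Longrightarrow> S \<subseteq> T \<Longrightarrow> test_function T \<phi>"
  by (auto simp: test_function_def)

lemma test_function_add:
  assumes "test_function S \<phi>" "test_function S \<psi>"
  shows "test_function S (\<lambda>x. \<phi> x + \<psi> x)"
proof -
  have "closure {x. \<phi> x + \<psi> x \<noteq> 0} \<subseteq> closure {x. \<phi> x \<noteq> 0} \<union> closure {x. \<psi> x \<noteq> 0}"
    unfolding closure_Un[symmetric] by (rule closure_mono) auto
  moreover from this have "compact (closure {x. \<phi> x + \<psi> x \<noteq> 0})"
    using assms unfolding test_function_def by (blast intro: compact_closure_subset compact_Un)
  ultimately show ?thesis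
    using assms Ck_add unfolding test_function_def by blast
qed

lemma test_function_bounded_linear:
  assumes \<phi>: "test_function S \<phi>" and L: "bounded_linear L"
  shows "test_function S (\<lambda>x. L (\<phi> x))"
proof -
  have "closure {x. L (\<phi> x) \<noteq> 0} \<subseteq> closure {x. \<phi> x \<noteq> 0}"
    by (rule closure_mono) (auto simp: linear_0[OF bounded_linear.linear[OF L]])
  moreover from this have "compact (closure {x. L (\<phi> x) \<noteq> 0})"
    using \<phi> unfolding test_function_def by (blast intro: compact_closure_subset)
  ultimately show ?thesis
    using \<phi> Ck_bounded_linear[OF L] unfolding test_function_def by blast
qed

lemmas test_function_scaleR = test_function_bounded_linear[OF _ bounded_linear_scaleR_right]

lemma restrict_L2_test_function:
  assumes "S \<in> sets lebesgue" "test_function S \<phi>"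
  shows "restrict_L2 S (to_L2 \<phi>) = to_L2 \<phi>"
proof -
  have "(\<lambda>x. indicator S x *\<^sub>R \<phi> x) = \<phi>"
    using assms(2) closure_subset[of "{x. \<phi> x \<noteq> 0}"]
    by (auto simp: test_function_def indicator_def fun_eq_iff)
  then show ?thesis
    using assms by (simp add: restrict_L2_to_L2 test_function_square_integrable)
qed

section \<open>Test functions separate points\<close>

text \<open>\<open>exp_bump 0\<close> is the function \<open>exp (- 1 / x)\<close>; the powers make the family closed under differentiation.\<close>

definition exp_bump :: "nat \<Rightarrow> real \<Rightarrow> real" where
  "exp_bump m x = (if 0 < x then inverse x ^ m * exp (- inverse x) else 0)"

text \<open>From the right, with y = 1/x, this is the decay of y^m / exp y; from the left the
  function is zero.\<close>

lemma exp_bump_tendsto_0: "(exp_bump m \<longlongrightarrow> 0) (at 0)"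
proof -
  have "((\<lambda>x. inverse x ^ m / exp (inverse x)) \<longlongrightarrow> (0::real)) (at_right 0)"
    by (rule filterlim_compose[OF tendsto_power_div_exp_0 filterlim_inverse_at_top_right])
  then have "(exp_bump m \<longlongrightarrow> 0) (at_right 0)"
    by (rule Lim_transform_eventually)
      (simp add: eventually_at_filter exp_bump_def exp_minus divide_inverse)
  moreover have "(exp_bump m \<longlongrightarrow> 0) (at_left 0)"
    by (rule tendsto_eventually) (simp add: eventually_at_filter exp_bump_def)
  ultimately show ?thesis using filterlim_split_at by blast
qed

text \<open>With y = 1/x one has dy/dx = - y^2, and differentiating y^m exp (- y) gives (y^(m+2) - m
  y^(m+1)) exp (- y). The same formula persists on the half-line where everything is zero, and at
  the origin.\<close>

lemma DERIV_exp_bump: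
  "(exp_bump m has_real_derivative exp_bump (m + 2) x - real m * exp_bump (m + 1) x) (at x)"
proof -
  consider "x < 0" | "x = 0" | "0 < x" by linarith
  then show ?thesis
  proof cases
    case 1
    have "((\<lambda>x. 0) has_real_derivative 0) (at x)" by simp
    then have "(exp_bump m has_real_derivative 0) (at x)"
      by (rule has_field_derivative_transform_within_open[of _ _ _ "{..<0}"])
        (use 1 in \<open>auto simp: exp_bump_def\<close>)
    then show ?thesis using 1 by (simp add: exp_bump_def)
  next
    case 2
    \<comment> \<open>Dividing by \<open>h\<close> raises the power by one: the difference quotient
      at 0 is \<open>exp_bump (Suc m)\<close>, which tends to 0.\<close>
    have "((\<lambda>h. (exp_bump m (0 + h) - exp_bump m 0) / h) \<longlongrightarrow> 0) (at 0)"
      by (rule Lim_transform_eventually[OF exp_bump_tendsto_0[of "Suc m"]])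
        (auto simp: eventually_at_filter exp_bump_def divide_inverse)
    then show ?thesis using 2 by (simp add: DERIV_def exp_bump_def)
  next
    case 3
    \<comment> \<open>The case split on \<open>m\<close> removes the exponent \<open>m - 1\<close>
      produced by the power rule.\<close>
    have "((\<lambda>x. inverse x ^ m * exp (- inverse x)) has_real_derivative
        exp_bump (m + 2) x - real m * exp_bump (m + 1) x) (at x)"
      using 3 by (auto intro!: derivative_eq_intros simp: exp_bump_def)
        (cases m; simp add: algebra_simps power2_eq_square)
    then show ?thesis
      by (rule has_field_derivative_transform_within_open[of _ _ _ "{0<..}"])
        (use 3 in \<open>auto simp: exp_bump_def\<close>)
  qed
qed

text \<open>The induction must range over all \<open>m\<close>, as each derivative raises the power.
  The affine argument with arbitrary sign of \<open>c\<close> serves both the lower and the upper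
  face of a box.\<close>

lemma Ck_exp_bump: "Ck n (\<lambda>x. exp_bump m (c * x $ i + d))"
proof (induction n arbitrary: m)
  case 0
  have "isCont (exp_bump m) y" for y
    using DERIV_exp_bump DERIV_isCont by blast
  then have "continuous_on UNIV (exp_bump m)"
    by (simp add: continuous_at_imp_continuous_on)
  then show ?case
    by (auto intro!: continuous_on_compose2[of UNIV "exp_bump m"] continuous_intros)
next
  case (Suc n)
  have D: "((\<lambda>x. exp_bump m (c * x $ i + d)) has_derivative
     (\<lambda>h. (exp_bump (m + 2) (c * x $ i + d) - real m * exp_bump (m + 1) (c * x $ i + d)) * (c * h $ i))) (at x)" for x
  proof -
    have "((\<lambda>x. c * x $ i + d) has_derivative (\<lambda>h. c * h $ i)) (at x)"
      by (auto intro!: derivative_eq_intros bounded_linear_imp_has_derivative bounded_linear_vec_nth)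
    from diff_chain_at[OF this DERIV_exp_bump[unfolded has_field_derivative_def]]
    show ?thesis by (simp add: o_def)
  qed
  have "pderiv_dir j (\<lambda>x. exp_bump m (c * x $ i + d)) =
      (\<lambda>x. (c * axis j 1 $ i) *\<^sub>R (exp_bump (m + 2) (c * x $ i + d) + (- real m) *\<^sub>R exp_bump (m + 1) (c * x $ i + d)))" for j
    by (simp add: fun_eq_iff pderiv_dir_eq[OF D])
  moreover have "Ck n (\<lambda>x. (c * axis j 1 $ i) *\<^sub>R (exp_bump (m + 2) (c * x $ i + d) + (- real m) *\<^sub>R exp_bump (m + 1) (c * x $ i + d)))" for j
    by (intro Ck_bounded_linear[OF bounded_linear_scaleR_right] Ck_add Suc)
  ultimately show ?case
    using D by (auto simp: differentiable_def)
qed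

text \<open>Each coordinate contributes one factor switching on at \<open>a\<close> and one
  switching off at \<open>b\<close>, so the product is positive exactly on the open box. The factor
  \<open>Suc n\<close> steepens the transition without moving it, which gives convergence to the
  indicator from inside the box.\<close>

definition box_bump :: "real^3 \<Rightarrow> real^3 \<Rightarrow> nat \<Rightarrow> real^3 \<Rightarrow> real" where
  "box_bump a b n x = (\<Prod>i\<in>UNIV. exp_bump 0 (real (Suc n) * x $ i + - real (Suc n) * a $ i)
     *\<^sub>R exp_bump 0 (- real (Suc n) * x $ i + real (Suc n) * b $ i))"

lemma smooth_box_bump: "smooth (box_bump a b n)"
  unfolding smooth_def box_bump_def[abs_def] by (intro allI Ck_prod Ck_scaleR_fun Ck_exp_bump)

lemma box_bump_eq:
  "box_bump a b n x = (if x \<in> box a b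
     then \<Prod>i\<in>UNIV. exp (- inverse (real (Suc n) * (x $ i - a $ i))) * exp (- inverse (real (Suc n) * (b $ i - x $ i)))
     else 0)"
proof -
  have 1: "0 < real (Suc n) * x $ i + - real (Suc n) * a $ i \<longleftrightarrow> a $ i < x $ i" for i
    by (simp add: algebra_simps del: of_nat_Suc)
  have 2: "0 < - real (Suc n) * x $ i + real (Suc n) * b $ i \<longleftrightarrow> x $ i < b $ i" for i
    by (simp add: algebra_simps del: of_nat_Suc)
  show ?thesis
  proof (cases "x \<in> box a b")
    case True
    then show ?thesis
      unfolding box_bump_def exp_bump_def 1 2
      by (simp add: mem_box_cart right_diff_distrib del: of_nat_Suc)
  next
    case False
    then obtain i where "\<not> (a $ i < x $ i \<and> x $ i < b $ i)" by (auto simp: mem_box_cart)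
    then show ?thesis
      using False unfolding box_bump_def exp_bump_def 1 2
      by (auto intro!: prod_zero bexI[of _ i])
  qed
qed

lemma box_bump_bounds: "0 \<le> box_bump a b n x" "box_bump a b n x \<le> 1"
proof -
  show "0 \<le> box_bump a b n x"
    by (simp add: box_bump_eq prod_nonneg)
  show "box_bump a b n x \<le> 1"
    unfolding box_bump_eq
    by (auto intro!: prod_le_1 mult_le_one simp: mem_box_cart less_imp_le simp del: of_nat_Suc)
qed

lemma box_bump_tendsto: "(\<lambda>n. box_bump a b n x) \<longlonglongrightarrow> indicator (box a b) x"
proof (cases "x \<in> box a b")
  case True
  \<comment> \<open>No condition on \<open>c\<close> is required: with \<open>inverse 0 = 0\<close>
    the inverse of the product splits for every \<open>c\<close>.\<close>
  have *: "(\<lambda>n. exp (- inverse (real (Suc n) * c))) \<longlonglongrightarrow> 1" for c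
  proof -
    have "(\<lambda>n. exp (- (inverse (real (Suc n)) * inverse c))) \<longlonglongrightarrow> exp (- (0 * inverse c))"
      by (intro tendsto_intros LIMSEQ_inverse_real_of_nat)
    then show ?thesis by simp
  qed
  have "(\<lambda>n. \<Prod>i\<in>UNIV. exp (- inverse (real (Suc n) * (x $ i - a $ i)))
      * exp (- inverse (real (Suc n) * (b $ i - x $ i)))) \<longlonglongrightarrow> (\<Prod>i\<in>(UNIV::3 set). 1 * 1)"
    by (intro tendsto_prod tendsto_mult *)
  then show ?thesis using True by (simp add: box_bump_eq del: of_nat_Suc)
qed (simp add: box_bump_eq)

lemma test_function_box_bump:
  assumes "cbox a b \<subseteq> S"
  shows "test_function S (box_bump a b n)"
proof -
  have "closure {x. box_bump a b n x \<noteq> 0} \<subseteq> cbox a b"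
    by (rule closure_minimal) (auto simp: box_bump_eq mem_box_cart less_imp_le split: if_splits)
  moreover from this have "compact (closure {x. box_bump a b n x \<noteq> 0})"
    by (rule compact_closure_subset[OF compact_cbox])
  ultimately show ?thesis
    using assms smooth_box_bump unfolding test_function_def smooth_def by blast
qed

text \<open>Boxes form an intersection-stable generator of the Borel sets, so vanishing integrals
  spread from boxes to all Borel sets by Dynkin's argument. The whole space is not a box;
  \<open>univ\<close> supplies it for the complement step.\<close>

lemma integral_zero_on_boxes_imp_AE_zero:
  fixes g :: "'a::euclidean_space \<Rightarrow> real"
  assumes g: "integrable lebesgue g"
    and box: "\<And>a b. set_lebesgue_integral lebesgue (box a b) g = 0"
    and univ: "integral\<^sup>L lebesgue g = 0"
  shows "AE x in lebesgue. g x = 0"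
proof -
  have borel: "set_lebesgue_integral lebesgue A g = 0" if "A \<in> sets borel" for A
  proof -
    let ?G = "range (\<lambda>(a, b). box a b :: 'a set)"
    have sg: "sets borel = sigma_sets UNIV ?G"
      by (simp add: borel_eq_box)
    have i: "set_integrable lebesgue A g" if "A \<in> sets borel" for A
      using that unfolding set_integrable_def by (intro integrable_mult_indicator g) auto
    have "Int_stable ?G"
      by (auto simp: Int_stable_def box_Int_box)
    moreover have "?G \<subseteq> Pow UNIV" by simp
    moreover have "A \<in> sigma_sets UNIV ?G" using that sg by blast
    ultimately show ?thesis
    proof (induction rule: sigma_sets_induct_disjoint)
      case (basic A)
      then show ?case using box by auto
    next
      case empty
      show ?case by (simp add: set_lebesgue_integral_def)
    next
      case (compl A)
      then have A: "A \<in> sets borel" by (simp add: sg)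
      have "set_lebesgue_integral lebesgue (A \<union> (UNIV - A)) g =
          set_lebesgue_integral lebesgue A g + set_lebesgue_integral lebesgue (UNIV - A) g"
        using A by (intro set_integral_Un i) auto
      then show ?case using compl univ by (simp add: set_lebesgue_integral_def)
    next
      case (union A)
      then have A: "A i \<in> sets borel" for i by (auto simp: sg)
      have "set_lebesgue_integral lebesgue (\<Union>i. A i) g = (\<Sum>i. set_lebesgue_integral lebesgue (A i) g)"
        using A union(1) by (intro lebesgue_integral_countable_add i) (auto simp: disjoint_family_on_def)
      then show ?case using union by simp
    qed
  qed
  show ?thesis
  proof (rule density_unique_real[where f' = "\<lambda>x. 0"])
    fix A :: "'a set" assume A: "A \<in> sets lebesgue"
    \<comment> \<open>A Lebesgue set differs from a Borel set by a null set, which does not affect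
      the integral.\<close>
    then obtain B N N' where B: "A = B \<union> N" "N \<subseteq> N'" "N' \<in> null_sets lborel" "B \<in> sets lborel"
      by (rule sets_completionE)
    have "(A - B) \<union> (B - A) \<subseteq> N'" using B by auto
    then have "(A - B) \<union> (B - A) \<in> null_sets lebesgue"
      using B(3) null_sets_completion_subset null_sets_completionI by blast
    then have "set_lebesgue_integral lebesgue A g = set_lebesgue_integral lebesgue B g"
      using A B(4) by (intro set_integral_null_delta g) auto
    then show "set_lebesgue_integral lebesgue A g = set_lebesgue_integral lebesgue A (\<lambda>x. 0)"
      using borel B(4) by (simp add: set_lebesgue_integral_def)
  qed (use g in auto)
qed

text \<open>Testing with a bump times a fixed vector \<open>v\<close> and letting the bumps tend to
  the indicator shows that every component of \<open>u\<close> has zero integral over each box whose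
  closure lies in \<open>S\<close>. Hence \<open>u\<close> vanishes on such boxes, and countably
  many of them exhaust \<open>S\<close>.\<close>

lemma test_functions_separate_L2:
  fixes u :: "'a::euclidean_space L2"
  assumes S: "open S" and u: "u \<in> L2_on S"
    and orth: "\<And>\<phi>. test_function S \<phi> \<Longrightarrow> u \<bullet> to_L2 \<phi> = 0"
  shows "u = 0"
proof -
  obtain f where f: "square_integrable f" "u = to_L2 f" by (rule L2_cases)
  have meas: "f \<in> borel_measurable lebesgue"
    using f by (simp add: square_integrable_def)
  have cb: "square_integrable (\<lambda>x. indicator (cbox a b) x *\<^sub>R (v::'a))" for a b v
  proof -
    have "integrable lebesgue (\<lambda>x. indicator (cbox a b) x *\<^sub>R (norm v)\<^sup>2)"
      by (intro integrable_scaleR_left) 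
        (use emeasure_lborel_cbox_finite[of a b] in \<open>auto simp: integrable_indicator_iff\<close>)
    moreover have "(\<lambda>x. (norm (indicat_real (cbox a b) x *\<^sub>R v))\<^sup>2) = (\<lambda>x. indicator (cbox a b) x *\<^sub>R (norm v)\<^sup>2)"
      by (auto simp: indicator_def fun_eq_iff)
    moreover have "(\<lambda>x. indicat_real (cbox a b) x *\<^sub>R v) \<in> borel_measurable lebesgue"
      by (intro borel_measurable_scaleR borel_measurable_indicator) simp_all
    ultimately show ?thesis by (simp add: square_integrable_def)
  qed
  have int_box: "integral\<^sup>L lebesgue (\<lambda>x. indicator (box a b) x * (f x \<bullet> v)) = 0"
    if "cbox a b \<subseteq> S" for a b v
  proof -
    \<comment> \<open>The bumps are at most 1 and live in the box, so the cutoff of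
      \<open>f x \<bullet> v\<close> to the closed box dominates; it is integrable as the inner
      product of two square-integrable functions.\<close>
    have "(\<lambda>n. integral\<^sup>L lebesgue (\<lambda>x. f x \<bullet> (box_bump a b n x *\<^sub>R v))) \<longlonglongrightarrow>
        integral\<^sup>L lebesgue (\<lambda>x. f x \<bullet> (indicator (box a b) x *\<^sub>R v))"
    proof (rule integral_dominated_convergence[where w = "\<lambda>x. \<bar>f x \<bullet> (indicator (cbox a b) x *\<^sub>R v)\<bar>"])
      have bump: "box_bump a b n \<in> borel_measurable lebesgue" for n
        using borel_measurable_continuous_onI[OF smooth_imp_continuous_on[OF smooth_box_bump]]
        by (simp add: measurable_completion)
      show "(\<lambda>x. f x \<bullet> (box_bump a b n x *\<^sub>R v)) \<in> borel_measurable lebesgue" for n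
        by (intro borel_measurable_inner borel_measurable_scaleR borel_measurable_const meas bump)
      show "(\<lambda>x. f x \<bullet> (indicat_real (box a b) x *\<^sub>R v)) \<in> borel_measurable lebesgue"
        by (intro borel_measurable_inner borel_measurable_scaleR borel_measurable_const meas
            borel_measurable_indicator) simp
      show "integrable lebesgue (\<lambda>x. \<bar>f x \<bullet> (indicator (cbox a b) x *\<^sub>R v)\<bar>)"
        by (intro integrable_abs integrable_inner_L2 f cb)
      show "AE x in lebesgue. (\<lambda>n. f x \<bullet> (box_bump a b n x *\<^sub>R v)) \<longlonglongrightarrow> f x \<bullet> (indicat_real (box a b) x *\<^sub>R v)"
        by (intro AE_I2 tendsto_intros box_bump_tendsto)
      show "AE x in lebesgue. norm (f x \<bullet> (box_bump a b n x *\<^sub>R v)) \<le> \<bar>f x \<bullet> (indicator (cbox a b) x *\<^sub>R v)\<bar>" for n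
      proof (rule AE_I2)
        fix x
        have "box_bump a b n x \<le> indicator (cbox a b) x"
          using box_bump_bounds(2)[of a b n x] box_subset_cbox[of a b]
          by (auto simp: indicator_def box_bump_eq)
        then show "norm (f x \<bullet> (box_bump a b n x *\<^sub>R v)) \<le> \<bar>f x \<bullet> (indicator (cbox a b) x *\<^sub>R v)\<bar>"
          using box_bump_bounds(1)[of a b n x] by (auto simp: abs_mult intro: mult_right_mono)
      qed
    qed
    moreover have "integral\<^sup>L lebesgue (\<lambda>x. f x \<bullet> (box_bump a b n x *\<^sub>R v)) = 0" for n
    proof -
      have t: "test_function S (\<lambda>x. box_bump a b n x *\<^sub>R v)"
        by (rule test_function_bounded_linear[OF test_function_box_bump[OF that] bounded_linear_scaleR_left])
      show ?thesis
        using orth[OF t] by (simp add: f inner_to_L2 test_function_square_integrable[OF t])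
    qed
    ultimately show ?thesis
      by (simp add: LIMSEQ_const_iff inner_scaleR_right)
  qed
  have zero_box: "AE x in lebesgue. x \<in> cbox a b \<longrightarrow> f x = 0" if ab: "cbox a b \<subseteq> S" for a b
  proof -
    have "AE x in lebesgue. indicator (box a b) x * (f x \<bullet> v) = 0" for v
    proof (rule integral_zero_on_boxes_imp_AE_zero)
      have "integrable lebesgue (\<lambda>x. indicator (box a b) x *\<^sub>R (f x \<bullet> (indicator (cbox a b) x *\<^sub>R v)))"
        by (intro integrable_mult_indicator integrable_inner_L2 f cb) simp
      also have "(\<lambda>x. indicator (box a b) x *\<^sub>R (f x \<bullet> (indicator (cbox a b) x *\<^sub>R v))) =
          (\<lambda>x. indicator (box a b) x * (f x \<bullet> v))"
        using box_subset_cbox[of a b] by (auto simp: indicator_def fun_eq_iff)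
      finally show "integrable lebesgue (\<lambda>x. indicator (box a b) x * (f x \<bullet> v))" .
      show "integral\<^sup>L lebesgue (\<lambda>x. indicator (box a b) x * (f x \<bullet> v)) = 0"
        by (rule int_box[OF ab])
      fix c d :: "real^3"
      \<comment> \<open>The same corners describe the intersection of the open and of the closed
        boxes, so the closed intersection stays inside \<open>S\<close> and \<open>int_box\<close>
        applies to it, wherever \<open>box c d\<close> lies.\<close>
      obtain p q where pq: "box a b \<inter> box c d = box p q" "cbox a b \<inter> cbox c d = cbox p q"
        by (rule that[OF box_Int_box Int_interval])
      then have "integral\<^sup>L lebesgue (\<lambda>x. indicator (box p q) x * (f x \<bullet> v)) = 0"
        using ab by (intro int_box) auto
      then show "set_lebesgue_integral lebesgue (box c d) (\<lambda>x. indicator (box a b) x * (f x \<bullet> v)) = 0"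
        unfolding pq(1)[symmetric] by (simp add: set_lebesgue_integral_def indicator_inter_arith ac_simps)
    qed
    then have "AE x in lebesgue. \<forall>v\<in>Basis. indicator (box a b) x * (f x \<bullet> v) = 0"
      by (intro AE_finite_allI) auto
    \<comment> \<open>The null boundary is added because the covering of \<open>S\<close> below
      consists of closed boxes.\<close>
    moreover have "AE x in lebesgue. x \<notin> cbox a b - box a b"
      using negligible_frontier_interval[of a b]
      by (intro AE_not_in) (simp add: negligible_iff_null_sets)
    ultimately show ?thesis
      by eventually_elim (auto simp: indicator_def intro: euclidean_eqI)
  qed
  obtain \<D> where \<D>: "countable \<D>" "\<D> \<subseteq> Pow S" "\<And>X. X \<in> \<D> \<Longrightarrow> \<exists>a b. X = cbox a b" "\<Union>\<D> = S"
    using open_countable_Union_open_cbox[OF S] by metis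
  have "AE x in lebesgue. \<forall>X\<in>\<D>. x \<in> X \<longrightarrow> f x = 0"
    using \<D>(2,3) zero_box by (subst AE_ball_countable[OF \<D>(1)]) blast
  then have "AE x in lebesgue. indicator S x *\<^sub>R f x = 0"
    by eventually_elim (use \<D>(4) in \<open>auto simp: indicator_def\<close>)
  moreover have "S \<in> sets lebesgue" using S by simp
  ultimately have "to_L2 (\<lambda>x. indicator S x *\<^sub>R f x) = to_L2 (\<lambda>x. 0)"
    using f by (subst to_L2_eq_iff) (auto simp: square_integrable_0 square_integrable_indicator)
  then show ?thesis
    using u f S by (simp add: L2_on_def restrict_L2_to_L2 to_L2_0)
qed

section \<open>Weak derivatives\<close>

lemma square_integrable_first_order_op:
  assumes "\<And>i. bounded_linear (L i)" "test_function S \<phi>"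
  shows "square_integrable (first_order_op L \<phi>)"
  using test_function_first_order_op[OF assms] by (rule test_function_square_integrable)

text \<open>\<open>T\<close> is the symbol of the formal adjoint, with the sign from integration by
  parts absorbed into it: minus divergence for the gradient, curl for the curl, minus gradient for
  the divergence.\<close>

definition weak_rel ::
  "(3 \<Rightarrow> 'b::euclidean_space \<Rightarrow> 'a::euclidean_space) \<Rightarrow> (real^3) set \<Rightarrow> 'a L2 \<Rightarrow> 'b L2 \<Rightarrow> bool" where
  "weak_rel T S u g \<longleftrightarrow> g \<in> L2_on S \<and>
     (\<forall>\<phi>. test_function S \<phi> \<longrightarrow> g \<bullet> to_L2 \<phi> = u \<bullet> to_L2 (first_order_op T \<phi>))"

lemma weak_rel_unique:
  assumes S: "open S" and "weak_rel T S u g" "weak_rel T S u h"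
  shows "g = h"
proof -
  have "g - h = 0"
    using assms(2,3) by (intro test_functions_separate_L2[OF S])
      (auto simp: weak_rel_def inner_diff_left S intro!: subspace_diff subspace_L2_on)
  then show ?thesis by simp
qed

lemma the_weak_rel: "open S \<Longrightarrow> weak_rel T S u g \<Longrightarrow> (THE g. weak_rel T S u g) = g"
  using weak_rel_unique by blast

lemma weak_rel_add:
  assumes "open S" "weak_rel T S u g" "weak_rel T S v h"
  shows "weak_rel T S (u + v) (g + h)"
  using assms by (auto simp: weak_rel_def inner_add_left intro!: subspace_add subspace_L2_on)

lemma weak_rel_scaleR:
  assumes "open S" "weak_rel T S u g"
  shows "weak_rel T S (c *\<^sub>R u) (c *\<^sub>R g)"
  using assms by (auto simp: weak_rel_def intro!: subspace_scale subspace_L2_on)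

text \<open>A test function on the smaller set is one on the larger set, and so is its derivative.
  Both are unchanged by the cutoff, which self-adjointness moves onto them.\<close>

lemma weak_rel_restrict:
  assumes T: "\<And>i. bounded_linear (T i)" and S: "open S" "open S'" "S' \<subseteq> S" and ug: "weak_rel T S u g"
  shows "weak_rel T S' (restrict_L2 S' u) (restrict_L2 S' g)"
  unfolding weak_rel_def
proof (intro conjI allI impI)
  show "restrict_L2 S' g \<in> L2_on S'"
    using S by (simp add: restrict_L2_in_L2_on)
  fix \<phi> :: "real^3 \<Rightarrow> 'a" assume \<phi>: "test_function S' \<phi>"
  have "test_function S' (first_order_op T \<phi>)"
    using T \<phi> by (rule test_function_first_order_op)
  then show "restrict_L2 S' g \<bullet> to_L2 \<phi> = restrict_L2 S' u \<bullet> to_L2 (first_order_op T \<phi>)"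
    using S \<phi> ug test_function_mono[OF \<phi> S(3)]
    by (simp add: inner_restrict_L2 restrict_L2_test_function weak_rel_def)
qed

text \<open>\<open>weak_rel_0 L T S u g\<close>: \<open>u\<close> lies in the closure of the test functions in the graph norm of the
  operator with symbol \<open>L\<close>, whose formal adjoint has symbol \<open>T\<close>, and \<open>g\<close> is its image.\<close>

definition weak_rel_0 ::
  "(3 \<Rightarrow> 'a::euclidean_space \<Rightarrow> 'b::euclidean_space) \<Rightarrow> (3 \<Rightarrow> 'b \<Rightarrow> 'a) \<Rightarrow> (real^3) set \<Rightarrow> 'a L2 \<Rightarrow> 'b L2 \<Rightarrow> bool"
  where
  "weak_rel_0 L T S u g \<longleftrightarrow> u \<in> L2_on S \<and> weak_rel T S u g \<and> (\<exists>\<phi>. (\<forall>n. test_function S (\<phi> n)) \<and>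
     (\<lambda>n. to_L2 (\<phi> n)) \<longlonglongrightarrow> u \<and> (\<lambda>n. to_L2 (first_order_op L (\<phi> n))) \<longlonglongrightarrow> g)"

lemma weak_rel_0_add:
  assumes L: "\<And>i. bounded_linear (L i)" and S: "open S"
    and ug: "weak_rel_0 L T S u g" and vh: "weak_rel_0 L T S v h"
  shows "weak_rel_0 L T S (u + v) (g + h)"
proof -
  obtain \<phi> where \<phi>: "\<And>n. test_function S (\<phi> n)" "(\<lambda>n. to_L2 (\<phi> n)) \<longlonglongrightarrow> u"
      "(\<lambda>n. to_L2 (first_order_op L (\<phi> n))) \<longlonglongrightarrow> g"
    using ug by (auto simp: weak_rel_0_def)
  obtain \<psi> where \<psi>: "\<And>n. test_function S (\<psi> n)" "(\<lambda>n. to_L2 (\<psi> n)) \<longlonglongrightarrow> v"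
      "(\<lambda>n. to_L2 (first_order_op L (\<psi> n))) \<longlonglongrightarrow> h"
    using vh by (auto simp: weak_rel_0_def)
  have D: "square_integrable (first_order_op L (\<phi> n))" "square_integrable (first_order_op L (\<psi> n))" for n
    by (rule square_integrable_first_order_op[OF L \<phi>(1)], rule square_integrable_first_order_op[OF L \<psi>(1)])
  have "to_L2 (\<lambda>x. \<phi> n x + \<psi> n x) = to_L2 (\<phi> n) + to_L2 (\<psi> n)" for n
    by (intro to_L2_add test_function_square_integrable[OF \<phi>(1)] test_function_square_integrable[OF \<psi>(1)])
  moreover have "to_L2 (first_order_op L (\<lambda>x. \<phi> n x + \<psi> n x)) =
      to_L2 (first_order_op L (\<phi> n)) + to_L2 (first_order_op L (\<psi> n))" for n
    unfolding first_order_op_add[OF L test_function_imp_smooth[OF \<phi>(1)] test_function_imp_smooth[OF \<psi>(1)]]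
    by (rule to_L2_add[OF D])
  ultimately have "(\<lambda>n. to_L2 (\<lambda>x. \<phi> n x + \<psi> n x)) \<longlonglongrightarrow> u + v"
    "(\<lambda>n. to_L2 (first_order_op L (\<lambda>x. \<phi> n x + \<psi> n x))) \<longlonglongrightarrow> g + h"
    using tendsto_add[OF \<phi>(2) \<psi>(2)] tendsto_add[OF \<phi>(3) \<psi>(3)] by simp_all
  moreover have "test_function S (\<lambda>x. \<phi> n x + \<psi> n x)" for n
    by (rule test_function_add[OF \<phi>(1) \<psi>(1)])
  moreover have "weak_rel T S (u + v) (g + h)"
    using ug vh by (intro weak_rel_add S) (simp_all add: weak_rel_0_def)
  moreover have "u + v \<in> L2_on S"
    using ug vh S by (intro subspace_add subspace_L2_on) (simp_all add: weak_rel_0_def)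
  ultimately show ?thesis
    unfolding weak_rel_0_def by (intro conjI exI[of _ "\<lambda>n x. \<phi> n x + \<psi> n x"] allI)
qed

lemma weak_rel_0_scaleR:
  assumes L: "\<And>i. bounded_linear (L i)" and S: "open S" and ug: "weak_rel_0 L T S u g"
  shows "weak_rel_0 L T S (c *\<^sub>R u) (c *\<^sub>R g)"
proof -
  obtain \<phi> where \<phi>: "\<And>n. test_function S (\<phi> n)" "(\<lambda>n. to_L2 (\<phi> n)) \<longlonglongrightarrow> u"
      "(\<lambda>n. to_L2 (first_order_op L (\<phi> n))) \<longlonglongrightarrow> g"
    using ug by (auto simp: weak_rel_0_def)
  have D: "square_integrable (first_order_op L (\<phi> n))" for n
    by (rule square_integrable_first_order_op[OF L \<phi>(1)])
  have "to_L2 (\<lambda>x. c *\<^sub>R \<phi> n x) = c *\<^sub>R to_L2 (\<phi> n)" for n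
    by (rule to_L2_scaleR[OF test_function_square_integrable[OF \<phi>(1)]])
  moreover have "to_L2 (first_order_op L (\<lambda>x. c *\<^sub>R \<phi> n x)) = c *\<^sub>R to_L2 (first_order_op L (\<phi> n))" for n
    unfolding first_order_op_scaleR[OF L test_function_imp_smooth[OF \<phi>(1)]]
    by (rule to_L2_scaleR[OF D])
  ultimately have "(\<lambda>n. to_L2 (\<lambda>x. c *\<^sub>R \<phi> n x)) \<longlonglongrightarrow> c *\<^sub>R u"
    "(\<lambda>n. to_L2 (first_order_op L (\<lambda>x. c *\<^sub>R \<phi> n x))) \<longlonglongrightarrow> c *\<^sub>R g"
    using tendsto_scaleR[OF tendsto_const \<phi>(2)] tendsto_scaleR[OF tendsto_const \<phi>(3)] by simp_all
  moreover have "test_function S (\<lambda>x. c *\<^sub>R \<phi> n x)" for n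
    by (rule test_function_scaleR[OF \<phi>(1)])
  moreover have "weak_rel T S (c *\<^sub>R u) (c *\<^sub>R g)"
    using ug by (intro weak_rel_scaleR S) (simp add: weak_rel_0_def)
  moreover have "c *\<^sub>R u \<in> L2_on S"
    using ug S by (intro subspace_scale subspace_L2_on) (simp_all add: weak_rel_0_def)
  ultimately show ?thesis
    unfolding weak_rel_0_def by (intro conjI exI[of _ "\<lambda>n x. c *\<^sub>R \<phi> n x"] allI)
qed

lemma weak_rel_0_zero:
  assumes L: "\<And>i. bounded_linear (L i)" and S: "open S"
  shows "weak_rel_0 L T S 0 0"
proof -
  have "test_function S (\<lambda>x. 0)"
    by (simp add: test_function_def Ck_const)
  moreover have "first_order_op L (\<lambda>x. 0) = (\<lambda>x. 0)"
    by (simp add: fun_eq_iff first_order_op_def pderiv_dir_def linear_0[OF bounded_linear.linear[OF L]])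
  ultimately show ?thesis
    using S by (auto simp: weak_rel_0_def weak_rel_def to_L2_0 subspace_0 subspace_L2_on
        intro!: exI[of _ "\<lambda>n x. 0"])
qed

text \<open>If test functions \<phi> n approximate \<open>u\<close> in the graph norm, then their
  images under \<open>L\<close> are test functions approximating \<open>g\<close>, and
  \<open>L'\<close> sends them all to 0. The identity for \<open>T\<close> and \<open>T'\<close>
  makes 0 the weak image of \<open>g\<close>. Thus the homogeneous boundary condition is inherited
  by the image.\<close>

lemma weak_rel_0_complex:
  assumes L: "\<And>i. bounded_linear (L i)" and T: "\<And>i. bounded_linear (T i)"
    and L': "\<And>i. bounded_linear (L' i)" and T': "\<And>i. bounded_linear (T' i)"
    and LL': "\<And>i j v. L' i (L j v) = - L' j (L i v)"
    and TT': "\<And>i j v. T i (T' j v) = - T j (T' i v)"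
    and S: "open S" and ug: "weak_rel_0 L T S u g"
  shows "weak_rel_0 L' T' S g 0"
proof -
  obtain \<phi> where \<phi>: "\<And>n. test_function S (\<phi> n)" "(\<lambda>n. to_L2 (first_order_op L (\<phi> n))) \<longlonglongrightarrow> g"
    using ug by (auto simp: weak_rel_0_def)
  have g: "g \<in> L2_on S" and ug': "weak_rel T S u g"
    using ug by (auto simp: weak_rel_0_def weak_rel_def)
  have "g \<bullet> to_L2 (first_order_op T' \<psi>) = 0" if \<psi>: "test_function S \<psi>" for \<psi>
  proof -
    have "first_order_op T (first_order_op T' \<psi>) = (\<lambda>x. 0)"
      by (rule first_order_op_comp_eq_0[OF T T' test_function_imp_smooth[OF \<psi>] TT'])
    then show ?thesis
      using ug' test_function_first_order_op[OF T' \<psi>] by (simp add: weak_rel_def to_L2_0)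
  qed
  then have "weak_rel T' S g 0"
    using S by (simp add: weak_rel_def subspace_0 subspace_L2_on)
  moreover have "first_order_op L' (first_order_op L (\<phi> n)) = (\<lambda>x. 0)" for n
    by (rule first_order_op_comp_eq_0[OF L' L test_function_imp_smooth[OF \<phi>(1)] LL'])
  moreover have "test_function S (first_order_op L (\<phi> n))" for n
    by (rule test_function_first_order_op[OF L \<phi>(1)])
  ultimately show ?thesis
    unfolding weak_rel_0_def
    by (intro conjI exI[of _ "\<lambda>n. first_order_op L (\<phi> n)"] allI g \<phi>(2)) (simp_all add: to_L2_0)
qed

section \<open>Gradient, curl and divergence as instances\<close>

lemma first_order_op_uminus: "first_order_op (\<lambda>i v. - L i v) \<phi> = (\<lambda>x. - first_order_op L \<phi> x)"
  by (simp add: fun_eq_iff first_order_op_def sum_negf)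

lemma to_L2_first_order_op_uminus:
  assumes L: "\<And>i. bounded_linear (L i)" and \<phi>: "test_function S \<phi>"
  shows "to_L2 (first_order_op (\<lambda>i v. - L i v) \<phi>) = - to_L2 (first_order_op L \<phi>)"
  using square_integrable_first_order_op[OF L \<phi>]
  by (simp add: first_order_op_uminus to_L2_uminus)

lemma has_weak_grad_iff: "has_weak_grad S u g \<longleftrightarrow> weak_rel (\<lambda>i v. - div_symbol i v) S u g"
  using to_L2_first_order_op_uminus[OF bounded_linear_symbol(3), of S]
  by (auto simp: has_weak_grad_def weak_rel_def div_cl_eq)

lemma has_weak_curl_iff: "has_weak_curl S u g \<longleftrightarrow> weak_rel curl_symbol S u g"
  by (auto simp: has_weak_curl_def weak_rel_def curl_cl_eq)

lemma has_weak_div_iff: "has_weak_div S u g \<longleftrightarrow> weak_rel (\<lambda>i v. - grad_symbol i v) S u g"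
  using to_L2_first_order_op_uminus[OF bounded_linear_symbol(1), of S]
  by (auto simp: has_weak_div_def weak_rel_def grad_cl_eq)

lemma weak_grad_eq: "open S \<Longrightarrow> weak_rel (\<lambda>i v. - div_symbol i v) S u g \<Longrightarrow> weak_grad S u = g"
  by (simp add: weak_grad_def has_weak_grad_iff the_weak_rel)

lemma weak_curl_eq: "open S \<Longrightarrow> weak_rel curl_symbol S u g \<Longrightarrow> weak_curl S u = g"
  by (simp add: weak_curl_def has_weak_curl_iff the_weak_rel)

lemma weak_div_eq: "open S \<Longrightarrow> weak_rel (\<lambda>i v. - grad_symbol i v) S u g \<Longrightarrow> weak_div S u = g"
  by (simp add: weak_div_def has_weak_div_iff the_weak_rel)

text \<open>The definition asks for some weak gradient and, separately, for convergence to
  \<open>weak_grad S u\<close>; uniqueness identifies the two. The same holds for the next two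
  spaces.\<close>

lemma H1_0_iff:
  "open S \<Longrightarrow> u \<in> H1_0 S \<longleftrightarrow> weak_rel_0 grad_symbol (\<lambda>i v. - div_symbol i v) S u (weak_grad S u)"
  using weak_grad_eq[of S u]
  by (auto simp: H1_0_def H1_def weak_rel_0_def has_weak_grad_iff grad_cl_eq)

lemma Hcurl_0_iff:
  "open S \<Longrightarrow> u \<in> Hcurl_0 S \<longleftrightarrow> weak_rel_0 curl_symbol curl_symbol S u (weak_curl S u)"
  using weak_curl_eq[of S u]
  by (auto simp: Hcurl_0_def Hcurl_def weak_rel_0_def has_weak_curl_iff curl_cl_eq)

lemma Hdiv_0_iff:
  "open S \<Longrightarrow> u \<in> Hdiv_0 S \<longleftrightarrow> weak_rel_0 div_symbol (\<lambda>i v. - grad_symbol i v) S u (weak_div S u)"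
  using weak_div_eq[of S u]
  by (auto simp: Hdiv_0_def Hdiv_def weak_rel_0_def has_weak_div_iff div_cl_eq)

lemma weak_rel_0D: "weak_rel_0 L T S u g \<Longrightarrow> weak_rel T S u g"
  by (simp add: weak_rel_0_def)

lemma weak_curl_add:
  assumes "open S" "u \<in> Hcurl_0 S" "v \<in> Hcurl_0 S"
  shows "weak_curl S (u + v) = weak_curl S u + weak_curl S v"
  using assms by (intro weak_curl_eq weak_rel_add weak_rel_0D) (simp_all add: Hcurl_0_iff)

lemma weak_curl_scaleR:
  assumes "open S" "u \<in> Hcurl_0 S"
  shows "weak_curl S (c *\<^sub>R u) = c *\<^sub>R weak_curl S u"
  using assms by (intro weak_curl_eq weak_rel_scaleR weak_rel_0D) (simp_all add: Hcurl_0_iff)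

lemma weak_grad_add:
  assumes "open S" "u \<in> H1_0 S" "v \<in> H1_0 S"
  shows "weak_grad S (u + v) = weak_grad S u + weak_grad S v"
  using assms by (intro weak_grad_eq weak_rel_add weak_rel_0D) (simp_all add: H1_0_iff)

lemma weak_grad_scaleR:
  assumes "open S" "u \<in> H1_0 S"
  shows "weak_grad S (c *\<^sub>R u) = c *\<^sub>R weak_grad S u"
  using assms by (intro weak_grad_eq weak_rel_scaleR weak_rel_0D) (simp_all add: H1_0_iff)

lemma weak_grad_0: "open S \<Longrightarrow> weak_grad S 0 = 0"
  by (rule weak_grad_eq[OF _ weak_rel_0D[OF weak_rel_0_zero[OF bounded_linear_symbol(1)]]])

lemma subspace_H1_0:
  assumes "open S"
  shows "subspace (H1_0 S)"
  using assms weak_rel_0_add[OF bounded_linear_symbol(1) assms]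
    weak_rel_0_scaleR[OF bounded_linear_symbol(1) assms] weak_rel_0_zero[OF bounded_linear_symbol(1) assms]
  by (auto simp: subspace_def H1_0_iff weak_grad_0 weak_grad_add[unfolded H1_0_iff[OF assms]]
      weak_grad_scaleR[unfolded H1_0_iff[OF assms]])

text \<open>\<open>weak_grad\<close> is known to be linear only on \<open>H1_0 S\<close>, so the
  closure properties of the image are checked there.\<close>

lemma subspace_weak_grad_image:
  assumes "open S" "subspace V" "V \<subseteq> H1_0 S"
  shows "subspace (weak_grad S ` V)"
  unfolding subspace_def
proof (intro conjI ballI allI)
  show "0 \<in> weak_grad S ` V"
    using weak_grad_0[OF assms(1)] subspace_0[OF assms(2)] by force
  fix x assume "x \<in> weak_grad S ` V"
  then obtain u where u: "u \<in> V" "x = weak_grad S u" by blast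
  show "c *\<^sub>R x \<in> weak_grad S ` V" for c
  proof
    show "c *\<^sub>R x = weak_grad S (c *\<^sub>R u)"
      using weak_grad_scaleR[OF assms(1) subsetD[OF assms(3) u(1)]] u(2) by simp
    show "c *\<^sub>R u \<in> V" by (rule subspace_scale[OF assms(2) u(1)])
  qed
  fix y assume "y \<in> weak_grad S ` V"
  then obtain v where v: "v \<in> V" "y = weak_grad S v" by blast
  show "x + y \<in> weak_grad S ` V"
  proof
    show "x + y = weak_grad S (u + v)"
      using weak_grad_add[OF assms(1) subsetD[OF assms(3) u(1)] subsetD[OF assms(3) v(1)]] u(2) v(2) by simp
    show "u + v \<in> V" by (rule subspace_add[OF assms(2) u(1) v(1)])
  qed
qed

lemma weak_grad_H1_0:
  assumes S: "open S" and u: "u \<in> H1_0 S"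
  shows "weak_grad S u \<in> Hcurl_0 S" "weak_curl S (weak_grad S u) = 0"
proof -
  have *: "weak_rel_0 curl_symbol curl_symbol S (weak_grad S u) 0"
  proof (rule weak_rel_0_complex)
    show "weak_rel_0 grad_symbol (\<lambda>i v. - div_symbol i v) S u (weak_grad S u)"
      using u by (simp add: H1_0_iff S)
    show "- div_symbol i (curl_symbol j v) = - (- div_symbol j (curl_symbol i v))" for i j v
      by (subst div_symbol_curl_symbol) (rule refl)
  qed (rule bounded_linear_symbol bounded_linear_minus curl_symbol_grad_symbol S)+
  then show c: "weak_curl S (weak_grad S u) = 0"
    by (intro weak_curl_eq S weak_rel_0D)
  show "weak_grad S u \<in> Hcurl_0 S"
    using * c S by (simp add: Hcurl_0_iff)
qed

lemma weak_curl_Hcurl_0: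
  assumes S: "open S" and u: "u \<in> Hcurl_0 S"
  shows "weak_curl S u \<in> Hdiv_0 S"
proof -
  \<comment> \<open>The formal adjoint of the divergence is minus the gradient, so the antisymmetry
    is needed with that sign inside the curl symbol.\<close>
  have curl_grad: "curl_symbol i (- grad_symbol j a) = - curl_symbol j (- grad_symbol i a)" for i j a
    using curl_symbol_grad_symbol[of i j a] linear_neg[OF bounded_linear.linear[OF bounded_linear_symbol(2)]]
    by metis
  have *: "weak_rel_0 div_symbol (\<lambda>i v. - grad_symbol i v) S (weak_curl S u) 0"
  proof (rule weak_rel_0_complex)
    show "weak_rel_0 curl_symbol curl_symbol S u (weak_curl S u)"
      using u by (simp add: Hcurl_0_iff S)
  qed (rule bounded_linear_symbol bounded_linear_minus div_symbol_curl_symbol curl_grad S)+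
  then have "weak_div S (weak_curl S u) = 0"
    by (intro weak_div_eq S weak_rel_0D)
  then show ?thesis
    using * S by (simp add: Hdiv_0_iff)
qed

lemma restrict_weak_grad:
  assumes "open S" "open S'" "S' \<subseteq> S" "u \<in> H1_0 S"
  shows "restrict_L2 S' (weak_grad S u) = weak_grad S' (restrict_L2 S' u)"
  using assms weak_rel_restrict[OF bounded_linear_minus[OF bounded_linear_symbol(3)] assms(1-3)]
  by (intro weak_grad_eq[symmetric]) (auto simp: H1_0_iff dest!: weak_rel_0D)

lemma restrict_weak_curl:
  assumes "open S" "open S'" "S' \<subseteq> S" "u \<in> Hcurl_0 S"
  shows "restrict_L2 S' (weak_curl S u) = weak_curl S' (restrict_L2 S' u)"
  using assms weak_rel_restrict[OF bounded_linear_symbol(2) assms(1-3)]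
  by (intro weak_curl_eq[symmetric]) (auto simp: Hcurl_0_iff dest!: weak_rel_0D)

lemma Hcurl_0_subset_L2_on: "Hcurl_0 S \<subseteq> L2_on S"
  by (auto simp: Hcurl_0_def Hcurl_def)

lemma Hdiv_0_subset_L2_on: "Hdiv_0 S \<subseteq> L2_on S"
  by (auto simp: Hdiv_0_def Hdiv_def)

section \<open>Broken spaces and their finite dimension\<close>

lemma subspace_broken_space:
  assumes "open \<Omega>" "\<And>k. k \<in> {1..K} \<Longrightarrow> open (\<Omega>k k)" "\<And>k. k \<in> {1..K} \<Longrightarrow> subspace (Vloc k)"
  shows "subspace (broken_space \<Omega> K \<Omega>k Vloc)"
  using assms subspace_L2_on[of \<Omega>]
  by (auto simp: broken_space_def subspace_def restrict_L2_add restrict_L2_scaleR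
      linear_0[OF linear_restrict_L2])

text \<open>The subdomains are disjoint and cover \<Omega> up to a null set, so their indicators add
  up to that of \<Omega> almost everywhere.\<close>

lemma L2_on_eq_sum_restrict:
  assumes part: "subdomain_partition \<Omega> K \<Omega>k" and \<Omega>: "open \<Omega>" and v: "v \<in> L2_on \<Omega>"
  shows "v = (\<Sum>k\<in>{1..K}. restrict_L2 (\<Omega>k k) v)"
proof -
  let ?I = "{1..K}"
  obtain f where f: "square_integrable f" "v = to_L2 f" by (rule L2_cases)
  have op: "open (\<Omega>k k)" "\<Omega>k k \<subseteq> \<Omega>" if "k \<in> ?I" for k
    using part that by (auto simp: subdomain_partition_def is_domain_def)
  have sq: "square_integrable (\<lambda>x. indicator (\<Omega>k k) x *\<^sub>R f x)" if "k \<in> ?I" for k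
    using op(1)[OF that] f by (simp add: square_integrable_indicator)
  have "AE x in lebesgue. x \<notin> \<Omega> - (\<Union>k\<in>?I. \<Omega>k k)"
    using part by (intro AE_not_in) (simp add: subdomain_partition_def negligible_iff_null_sets)
  then have "AE x in lebesgue. indicator \<Omega> x *\<^sub>R f x = (\<Sum>k\<in>?I. indicator (\<Omega>k k) x *\<^sub>R f x)"
  proof eventually_elim
    case (elim x)
    then have "x \<in> \<Omega> \<longleftrightarrow> x \<in> (\<Union>k\<in>?I. \<Omega>k k)"
      using op(2) by blast
    then have "indicat_real \<Omega> x = indicator (\<Union>k\<in>?I. \<Omega>k k) x"
      by (simp add: indicator_def)
    also have "\<dots> = (\<Sum>k\<in>?I. indicator (\<Omega>k k) x)"
      using part by (intro indicator_UN_disjoint) (auto simp: subdomain_partition_def)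
    finally show ?case by (simp add: scaleR_sum_left)
  qed
  then have "to_L2 (\<lambda>x. indicator \<Omega> x *\<^sub>R f x) = to_L2 (\<lambda>x. \<Sum>k\<in>?I. indicator (\<Omega>k k) x *\<^sub>R f x)"
  proof (subst to_L2_eq_iff)
    show "square_integrable (\<lambda>x. indicator \<Omega> x *\<^sub>R f x)"
      using f \<Omega> by (intro square_integrable_indicator) simp_all
    show "square_integrable (\<lambda>x. \<Sum>k\<in>?I. indicator (\<Omega>k k) x *\<^sub>R f x)"
      by (rule square_integrable_sum[OF sq])
  qed
  also have "\<dots> = (\<Sum>k\<in>?I. to_L2 (\<lambda>x. indicator (\<Omega>k k) x *\<^sub>R f x))"
    by (rule to_L2_sum[OF sq])
  also have "\<dots> = (\<Sum>k\<in>?I. restrict_L2 (\<Omega>k k) v)"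
    using op(1) f by (intro sum.cong refl) (simp add: restrict_L2_to_L2)
  finally show ?thesis
    using v f \<Omega> by (simp add: L2_on_def restrict_L2_to_L2)
qed

text \<open>Extension by zero puts all local spaces into one vector space. A broken function is the
  sum of its pieces, so the union of the finite local spanning sets spans.\<close>

lemma fin_dim_broken_space:
  assumes part: "subdomain_partition \<Omega> K \<Omega>k" and \<Omega>: "open \<Omega>"
    and V: "\<And>k. k \<in> {1..K} \<Longrightarrow> fin_dim_subspace (Vloc k)"
  shows "fin_dim_subspace (broken_space \<Omega> K \<Omega>k Vloc)"
  unfolding fin_dim_subspace_def
proof
  show "subspace (broken_space \<Omega> K \<Omega>k Vloc)"
    using V part by (intro subspace_broken_space \<Omega>)
      (auto simp: fin_dim_subspace_def subdomain_partition_def is_domain_def)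
  have "\<forall>k. \<exists>B. k \<in> {1..K} \<longrightarrow> finite B \<and> Vloc k \<subseteq> span B"
    using V by (auto simp: fin_dim_subspace_def)
  then obtain B where B: "\<And>k. k \<in> {1..K} \<Longrightarrow> finite (B k) \<and> Vloc k \<subseteq> span (B k)"
    by metis
  let ?B = "\<Union>k\<in>{1..K}. B k"
  have "broken_space \<Omega> K \<Omega>k Vloc \<subseteq> span ?B"
  proof
    fix v assume v: "v \<in> broken_space \<Omega> K \<Omega>k Vloc"
    have "(\<Sum>k\<in>{1..K}. restrict_L2 (\<Omega>k k) v) \<in> span ?B"
    proof (rule span_sum)
      fix k assume k: "k \<in> {1..K}"
      then have "restrict_L2 (\<Omega>k k) v \<in> span (B k)"
        using v B[OF k] unfolding broken_space_def by blast
      then show "restrict_L2 (\<Omega>k k) v \<in> span ?B"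
        using span_mono[of "B k" ?B] k by blast
    qed
    then show "v \<in> span ?B"
      using L2_on_eq_sum_restrict[OF part \<Omega>, of v] v by (simp add: broken_space_def)
  qed
  then show "\<exists>B. finite B \<and> broken_space \<Omega> K \<Omega>k Vloc \<subseteq> span B"
    using B by (intro exI[of _ ?B]) auto
qed

section \<open>The eigenproblem\<close>

text \<open>Induction on the spanning set with one Gram-Schmidt step: a representative on the old
  span is corrected along the component of the new vector orthogonal to that span.\<close>

lemma riesz_span:
  fixes l :: "'v::real_inner \<Rightarrow> real"
  assumes "finite B"
    and "\<And>x y. x \<in> span B \<Longrightarrow> y \<in> span B \<Longrightarrow> l (x + y) = l x + l y"
    and "\<And>c x. x \<in> span B \<Longrightarrow> l (c *\<^sub>R x) = c * l x"
  shows "\<exists>z\<in>span B. \<forall>x\<in>span B. z \<bullet> x = l x"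
  using assms
proof (induction B arbitrary: l rule: finite_induct)
  case empty
  then show ?case using empty(2)[of 0 0] by simp
next
  case (insert b B)
  have sub: "span B \<subseteq> span (insert b B)" by (rule span_mono) blast
  obtain z where z: "z \<in> span B" "\<And>x. x \<in> span B \<Longrightarrow> z \<bullet> x = l x"
    using insert.IH[of l] insert.prems sub by (meson subsetD)
  \<comment> \<open>The induction hypothesis is used a second time, for the functional
    \<open>inner b\<close>; its representative is the orthogonal projection of \<open>b\<close> onto
    \<open>span B\<close>.\<close>
  obtain p where p: "p \<in> span B" "\<And>x. x \<in> span B \<Longrightarrow> p \<bullet> x = b \<bullet> x"
    using insert.IH[of "inner b"] by (auto simp: inner_add_right)
  define b' where "b' = b - p"
  have orth: "b' \<bullet> x = 0" if "x \<in> span B" for x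
    using p(2)[OF that] by (simp add: b'_def inner_diff_left)
  have b': "b' \<in> span (insert b B)"
    using p(1) sub by (auto simp: b'_def intro: span_diff span_base)
  show ?case
  proof (cases "b' = 0")
    case True
    then have "span (insert b B) = span B" using p(1) by (simp add: b'_def span_redundant)
    then show ?thesis using z by auto
  next
    case False
    then have nz: "b' \<bullet> b' \<noteq> 0" by simp
    \<comment> \<open>The coefficient is dictated by \<open>w \<bullet> b' = l b'\<close>;
      orthogonality keeps the values on \<open>span B\<close> unchanged.\<close>
    define w where "w = z + (l b' / (b' \<bullet> b')) *\<^sub>R b'"
    have "w \<bullet> x = l x" if x: "x \<in> span (insert b B)" for x
    proof -
      obtain k where k: "x - k *\<^sub>R b \<in> span B"
        using x by (auto simp: span_breakdown_eq)
      define s where "s = (x - k *\<^sub>R b) + k *\<^sub>R p"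
      have s: "s \<in> span B" unfolding s_def by (intro span_add span_scale k p)
      have xs: "x = k *\<^sub>R b' + s" by (simp add: s_def b'_def algebra_simps)
      have "l x = k * l b' + l s"
        unfolding xs using insert.prems b' s sub by (simp add: span_scale subset_iff)
      moreover have "w \<bullet> x = z \<bullet> s + (l b' / (b' \<bullet> b')) * k * (b' \<bullet> b')"
        unfolding xs w_def using orth[OF z(1)] orth[OF s]
        by (simp add: inner_add_left inner_add_right inner_commute)
      ultimately show ?thesis using z(2)[OF s] nz by simp
    qed
    moreover have "w \<in> span (insert b B)"
      unfolding w_def using z(1) b' sub by (intro span_add span_scale) auto
    ultimately show ?thesis by blast
  qed
qed

lemma fin_dim_subspace_eq_span:
  assumes "fin_dim_subspace V"
  obtains B where "finite B" "V = span B"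
proof -
  obtain C where C: "subspace V" "finite C" "V \<subseteq> span C"
    using assms by (auto simp: fin_dim_subspace_def)
  obtain B where B: "B \<subseteq> V" "independent B" "V \<subseteq> span B"
    by (rule basis_exists)
  have "finite B" using independent_span_bound[OF C(2) B(2)] B(1) C(3) by blast
  moreover have "V = span B" using B C(1) by (simp add: span_minimal subset_antisym)
  ultimately show thesis by (rule that)
qed

lemma fin_dim_subspace_subset:
  "fin_dim_subspace V \<Longrightarrow> subspace U \<Longrightarrow> U \<subseteq> V \<Longrightarrow> fin_dim_subspace U"
  unfolding fin_dim_subspace_def by blast

lemma orthogonal_projection_exists:
  fixes V :: "'v::real_inner set"
  assumes "fin_dim_subspace V"
  obtains p where "p \<in> V" "\<And>x. x \<in> V \<Longrightarrow> (w - p) \<bullet> x = 0"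
proof -
  obtain B where B: "finite B" "V = span B" by (rule fin_dim_subspace_eq_span[OF assms])
  then show thesis
    using riesz_span[of B "inner w"] that by (auto simp: inner_add_right inner_diff_left)
qed

text \<open>Existence is Riesz for the functional \<open>x \<mapsto> y \<bullet> A x\<close>, and
  uniqueness follows by testing with the difference. The free \<open>z\<close> turns operator
  equations into variational ones.\<close>

lemma adjoint_on_eq_iff:
  fixes A :: "'v::real_inner \<Rightarrow> 'w::real_inner"
  assumes X: "fin_dim_subspace X"
    and A: "\<And>x x'. x \<in> X \<Longrightarrow> x' \<in> X \<Longrightarrow> A (x + x') = A x + A x'"
      "\<And>c x. x \<in> X \<Longrightarrow> A (c *\<^sub>R x) = c *\<^sub>R A x"
    and y: "y \<in> Y"
  shows "adjoint_on X Y A y = z \<longleftrightarrow> z \<in> X \<and> (\<forall>x\<in>X. z \<bullet> x = y \<bullet> A x)"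
proof -
  obtain B where B: "finite B" "X = span B" by (rule fin_dim_subspace_eq_span[OF X])
  have ex: "\<exists>z\<in>X. \<forall>x\<in>X. z \<bullet> x = y \<bullet> A x"
    using riesz_span[OF B(1), of "\<lambda>x. y \<bullet> A x"] A by (simp add: B(2) inner_add_right)
  have unique: "z = z'"
    if "z \<in> X" "\<forall>x\<in>X. z \<bullet> x = y \<bullet> A x" "z' \<in> X" "\<forall>x\<in>X. z' \<bullet> x = y \<bullet> A x" for z z'
  proof -
    have "z - z' \<in> X" using that X by (simp add: fin_dim_subspace_def subspace_diff)
    then have "(z - z') \<bullet> (z - z') = 0" using that by (simp add: inner_diff_left)
    then show ?thesis by simp
  qed
  from ex obtain z0 where z0: "z0 \<in> X" "\<forall>x\<in>X. z0 \<bullet> x = y \<bullet> A x" by blast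
  have "adjoint_on X Y A y = z0"
    unfolding adjoint_on_def using y z0 unique by (auto intro!: the_equality)
  then show ?thesis using z0 unique by blast
qed

lemma adjoint_on_works:
  assumes "fin_dim_subspace X"
    and "\<And>x x'. x \<in> X \<Longrightarrow> x' \<in> X \<Longrightarrow> A (x + x') = A x + A x'"
      "\<And>c x. x \<in> X \<Longrightarrow> A (c *\<^sub>R x) = c *\<^sub>R A x"
    and "y \<in> Y"
  shows "adjoint_on X Y A y \<in> X" "\<And>x. x \<in> X \<Longrightarrow> adjoint_on X Y A y \<bullet> x = y \<bullet> A x"
  using adjoint_on_eq_iff[OF assms, of "adjoint_on X Y A y"] by auto

section \<open>Projections and the abstract eigenproblem\<close>

lemma linear_projection_onD:
  assumes "linear_projection_on V W P"
  shows "\<And>x y. x \<in> V \<Longrightarrow> y \<in> V \<Longrightarrow> P (x + y) = P x + P y"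
    and "\<And>c x. x \<in> V \<Longrightarrow> P (c *\<^sub>R x) = c *\<^sub>R P x"
    and "\<And>x. x \<in> V \<Longrightarrow> P x \<in> W"
    and "W \<subseteq> V"
    and "\<And>x. x \<in> W \<Longrightarrow> P x = x"
  using assms by (auto simp: linear_projection_on_def)

lemma linear_projection_on_diff:
  assumes "subspace V" "linear_projection_on V W P" "x \<in> V" "y \<in> V"
  shows "P (x - y) = P x - P y"
proof -
  note P = linear_projection_onD[OF assms(2)]
  have "(-1) *\<^sub>R y \<in> V" using assms by (blast intro: subspace_scale)
  then have "P (x + (-1) *\<^sub>R y) = P x + (-1) *\<^sub>R P y"
    using P(1)[OF assms(3)] P(2)[OF assms(4)] by metis
  then show ?thesis by simp
qed

lemma subspace_linear_projection_on_range:
  assumes "subspace V" "linear_projection_on V W P"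
  shows "subspace W"
proof -
  note P = linear_projection_onD[OF assms(2)]
  have "0 \<in> W" using P(2,3)[of 0] assms(1) P(2)[of 0 0] by (metis scale_zero_left subspace_0)
  moreover have "x + y \<in> W" if "x \<in> W" "y \<in> W" for x y
    using that P(3)[of "x + y"] P(1)[of x y] P(4,5) assms(1) by (metis subsetD subspace_add)
  moreover have "c *\<^sub>R x \<in> W" if "x \<in> W" for c x
    using that P(3)[of "c *\<^sub>R x"] P(2)[of x c] P(4,5) assms(1) by (metis subsetD subspace_scale)
  ultimately show ?thesis by (auto simp: subspace_def)
qed

lemma nonconforming_eigenproblem_iff:
  fixes V W :: "'v::real_inner set" and Y Z :: "'w::real_inner set"
  assumes V: "fin_dim_subspace V" and P: "linear_projection_on V W P"
    and A: "\<And>x y. x \<in> W \<Longrightarrow> y \<in> W \<Longrightarrow> A (x + y) = A x + A y"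
      "\<And>c x. x \<in> W \<Longrightarrow> A (c *\<^sub>R x) = c *\<^sub>R A x"
    and AZ: "\<And>x. x \<in> W \<Longrightarrow> A x \<in> Z" and ZY: "Z \<subseteq> Y"
    and lam: "lam \<noteq> 0"
  shows "u \<in> V - {0} \<and> adjoint_on V Y (\<lambda>v. A (P v)) (A (P u)) =
      lam *\<^sub>R (adjoint_on V V P (P u) + adjoint_on V V (\<lambda>v. v - P v) (u - P u))
    \<longleftrightarrow> u \<in> W - {0} \<and> adjoint_on W Z A (A u) = lam *\<^sub>R u"
proof -
  note PD = linear_projection_onD[OF P]
  have sV: "subspace V" using V by (simp add: fin_dim_subspace_def)
  have sW: "subspace W" by (rule subspace_linear_projection_on_range[OF sV P])
  have fW: "fin_dim_subspace W" by (rule fin_dim_subspace_subset[OF V sW PD(4)])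
  have PV: "P x \<in> V" "x - P x \<in> V" "P (x - P x) = 0" if "x \<in> V" for x
  proof -
    show *: "P x \<in> V" using PD(3)[OF that] PD(4) by blast
    show "x - P x \<in> V" using sV that * by (rule subspace_diff)
    show "P (x - P x) = 0"
      using linear_projection_on_diff[OF sV P that *] PD(5)[OF PD(3)[OF that]] by simp
  qed
  have A0: "A 0 = 0" using A(2)[of 0 0] sW by (simp add: subspace_0)
  \<comment> \<open>The whole right side lies in \<open>V\<close>, so it equals the adjoint value
    exactly when both have the same products with every element of \<open>V\<close>.\<close>
  have weak: "adjoint_on V Y (\<lambda>v. A (P v)) (A (P u)) =
      lam *\<^sub>R (adjoint_on V V P (P u) + adjoint_on V V (\<lambda>v. v - P v) (u - P u)) \<longleftrightarrow>
      (\<forall>x\<in>V. A (P u) \<bullet> A (P x) = lam * (P u \<bullet> P x + (u - P u) \<bullet> (x - P x)))" if u: "u \<in> V"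
  proof -
    have 1: "adjoint_on V V P (P u) \<in> V" "\<And>x. x \<in> V \<Longrightarrow> adjoint_on V V P (P u) \<bullet> x = P u \<bullet> P x"
      by (rule adjoint_on_works[OF V]; simp add: PD PV u)+
    have 2: "adjoint_on V V (\<lambda>v. v - P v) (u - P u) \<in> V"
      "\<And>x. x \<in> V \<Longrightarrow> adjoint_on V V (\<lambda>v. v - P v) (u - P u) \<bullet> x = (u - P u) \<bullet> (x - P x)"
      by (rule adjoint_on_works[OF V]; simp add: PD PV u algebra_simps)+
    have 3: "A (P u) \<in> Y" using AZ PD(3) u ZY by blast
    show ?thesis
      by (subst adjoint_on_eq_iff[OF V _ _ 3])
        (use 1 2 sV in \<open>auto simp: PD A inner_add_left subspace_add subspace_scale\<close>)
  qed
  have conf: "adjoint_on W Z A (A u) = lam *\<^sub>R u \<longleftrightarrow> (\<forall>x\<in>W. A u \<bullet> A x = lam * (u \<bullet> x))" if "u \<in> W"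
    by (subst adjoint_on_eq_iff[OF fW A AZ[OF that]])
      (use that sW in \<open>auto simp: subspace_scale\<close>)
  show ?thesis
  proof (intro iffI conjI; (elim conjE)?)
    assume u: "u \<in> V - {0}" and e: "adjoint_on V Y (\<lambda>v. A (P v)) (A (P u)) =
      lam *\<^sub>R (adjoint_on V V P (P u) + adjoint_on V V (\<lambda>v. v - P v) (u - P u))"
    then have *: "A (P u) \<bullet> A (P x) = lam * (P u \<bullet> P x + (u - P u) \<bullet> (x - P x))" if "x \<in> V" for x
      using weak that by blast
    have "(u - P u) \<bullet> (u - P u) = 0"
      using *[of "u - P u"] PV[of u] u A0 lam by simp
    then have Pu: "P u = u" by simp
    then show uW: "u \<in> W - {0}" using u PD(3)[of u] by auto
    have "A u \<bullet> A x = lam * (u \<bullet> x)" if "x \<in> W" for x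
      using *[of x] that PD(4,5) Pu by auto
    then show "adjoint_on W Z A (A u) = lam *\<^sub>R u"
      using conf uW by blast
  next
    assume u: "u \<in> W - {0}" and e: "adjoint_on W Z A (A u) = lam *\<^sub>R u"
    then have *: "A u \<bullet> A x = lam * (u \<bullet> x)" if "x \<in> W" for x
      using conf that by blast
    show uV: "u \<in> V - {0}" using u PD(4) by blast
    \<comment> \<open>Since \<open>P u = u\<close>, the second term drops out, and what remains is
      the conforming equation tested with \<open>P x\<close>.\<close>
    have "A (P u) \<bullet> A (P x) = lam * (P u \<bullet> P x + (u - P u) \<bullet> (x - P x))" if "x \<in> V" for x
      using *[of "P x"] PD(3)[OF that] PD(5)[of u] u by simp
    then show "adjoint_on V Y (\<lambda>v. A (P v)) (A (P u)) =
      lam *\<^sub>R (adjoint_on V V P (P u) + adjoint_on V V (\<lambda>v. v - P v) (u - P u))"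
      using weak uV by blast
  qed
qed

text \<open>The existential names the inner sum of the nested decomposition; its witness is the
  kernel of \<open>A\<close> on \<open>W\<close>. The outer sum is only claimed to be direct, as
  \<open>P\<close> may be an oblique projection.\<close>

lemma nonconforming_kernel_decomposition:
  fixes V W U H :: "'v::real_inner set" and Y :: "'w::real_inner set"
  assumes V: "fin_dim_subspace V" and P: "linear_projection_on V W P"
    and A: "\<And>x y. x \<in> W \<Longrightarrow> y \<in> W \<Longrightarrow> A (x + y) = A x + A y"
      "\<And>c x. x \<in> W \<Longrightarrow> A (c *\<^sub>R x) = c *\<^sub>R A x"
    and AY: "\<And>x. x \<in> W \<Longrightarrow> A x \<in> Y"
    and U: "subspace U" "U \<subseteq> W" "\<And>x. x \<in> U \<Longrightarrow> A x = 0"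
    and H: "H = {v \<in> W. A v = 0 \<and> (\<forall>x\<in>U. x \<bullet> v = 0)}"
  shows "\<exists>N. is_orthogonal_direct_sum N U H \<and>
    is_direct_sum {u \<in> V. adjoint_on V Y (\<lambda>v. A (P v)) (A (P u)) = 0} N ((\<lambda>v. v - P v) ` V)"
proof (intro exI conjI)
  let ?N = "{v \<in> W. A v = 0}" and ?Q = "\<lambda>v. v - P v"
  note PD = linear_projection_onD[OF P]
  have sV: "subspace V" using V by (simp add: fin_dim_subspace_def)
  have sW: "subspace W" by (rule subspace_linear_projection_on_range[OF sV P])
  have fU: "fin_dim_subspace U" using U PD(4) by (intro fin_dim_subspace_subset[OF V]) auto
  have A0: "A 0 = 0" using A(2)[of 0 0] sW by (simp add: subspace_0)
  have sN: "subspace ?N"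
    using sW A A0 by (auto simp: subspace_def)
  have sH: "subspace H"
    using sW A A0 by (auto simp: H subspace_def inner_add_right)
  have UN: "U \<subseteq> ?N" using U by blast
  have "\<exists>a\<in>U. \<exists>b\<in>H. v = a + b" if v: "v \<in> ?N" for v
  proof -
    \<comment> \<open>Projecting orthogonally onto \<open>U\<close> leaves a remainder in the kernel
      of \<open>A\<close> and orthogonal to \<open>U\<close>, hence in \<open>H\<close>.\<close>
    obtain p where p: "p \<in> U" "\<And>x. x \<in> U \<Longrightarrow> (v - p) \<bullet> x = 0"
      using orthogonal_projection_exists[OF fU, where w = v] by blast
    have "v - p \<in> ?N" using v p(1) UN by (intro subspace_diff[OF sN]) auto
    then have "v - p \<in> H" using p(2) by (auto simp: H inner_commute)
    then show ?thesis using p(1) by force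
  qed
  moreover have "a + b \<in> ?N" if "a \<in> U" "b \<in> H" for a b
    using that UN by (intro subspace_add[OF sN]) (auto simp: H)
  ultimately have "?N = {a + b | a b. a \<in> U \<and> b \<in> H}" by blast
  moreover have "U \<inter> H = {0}"
    using subspace_0[OF U(1)] subspace_0[OF sH] by (auto simp: H)
  ultimately show "is_orthogonal_direct_sum ?N U H"
    using U(1) sH by (auto simp: is_orthogonal_direct_sum_def is_direct_sum_def H)
  have ker: "{u \<in> V. adjoint_on V Y (\<lambda>v. A (P v)) (A (P u)) = 0} = {u \<in> V. A (P u) = 0}"
  proof -
    have "adjoint_on V Y (\<lambda>v. A (P v)) (A (P u)) = 0 \<longleftrightarrow> A (P u) = 0" if "u \<in> V" for u
    proof -
      have "adjoint_on V Y (\<lambda>v. A (P v)) (A (P u)) = 0 \<longleftrightarrow> (\<forall>x\<in>V. 0 = A (P u) \<bullet> A (P x))"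
        by (subst adjoint_on_eq_iff[OF V])
          (use AY PD(3)[OF that] sV in \<open>auto simp: PD A subspace_0\<close>)
      also have "\<dots> \<longleftrightarrow> A (P u) = 0"
      proof
        assume "\<forall>x\<in>V. 0 = A (P u) \<bullet> A (P x)"
        from bspec[OF this that] have "A (P u) \<bullet> A (P u) = 0" by (rule sym)
        then show "A (P u) = 0" unfolding inner_eq_zero_iff .
      next
        assume "A (P u) = 0"
        then show "\<forall>x\<in>V. 0 = A (P u) \<bullet> A (P x)" by simp
      qed
      finally show ?thesis .
    qed
    then show ?thesis by blast
  qed
  have PV: "P x \<in> V" "x - P x \<in> V" "P (x - P x) = 0" if "x \<in> V" for x
  proof -
    show *: "P x \<in> V" using PD(3)[OF that] PD(4) by blast
    show "x - P x \<in> V" using sV that * by (rule subspace_diff)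
    show "P (x - P x) = 0"
      using linear_projection_on_diff[OF sV P that *] PD(5)[OF PD(3)[OF that]] by simp
  qed
  \<comment> \<open>Rewriting the range of I - P as the kernel of \<open>P\<close> makes the trivial
    intersection immediate, since \<open>P\<close> is the identity on \<open>W\<close>.\<close>
  have QV: "?Q ` V = {v \<in> V. P v = 0}"
    using PV by force
  have "subspace {v \<in> V. P v = 0}"
    using sV PD(1,2) PD(2)[of 0 0] by (auto simp: subspace_def)
  moreover have "?N \<inter> {v \<in> V. P v = 0} = {0}"
    using PD(4,5) PD(2)[of 0 0] A0 subspace_0[OF sW] by force
  moreover have "{u \<in> V. A (P u) = 0} = {a + b | a b. a \<in> ?N \<and> b \<in> {v \<in> V. P v = 0}}"
  proof safe
    fix u assume u: "u \<in> V" "A (P u) = 0"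
    then show "\<exists>a b. u = a + b \<and> a \<in> ?N \<and> b \<in> {v \<in> V. P v = 0}"
      using PV PD(3) by (intro exI[of _ "P u"] exI[of _ "u - P u"]) auto
  next
    fix a b assume ab: "a \<in> W" "A a = 0" "b \<in> V" "P b = 0"
    show "a + b \<in> V" using ab PD(4) by (intro subspace_add[OF sV]) auto
    show "A (P (a + b)) = 0" using ab PD(1)[of a b] PD(4,5) by auto
  qed
  ultimately show "is_direct_sum {u \<in> V. adjoint_on V Y (\<lambda>v. A (P v)) (A (P u)) = 0} ?N (?Q ` V)"
    unfolding ker QV is_direct_sum_def using sN by blast
qed

theorem proposition3p4:
  fixes \<Omega> :: "(real^3) set" and K :: nat and \<Omega>k :: "nat \<Rightarrow> (real^3) set"
    and V0loc :: "nat \<Rightarrow> real L2 set"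
    and V1loc V2loc :: "nat \<Rightarrow> (real^3) L2 set"
    and V0h V0c :: "real L2 set"
    and V1h V1c V2h V2c harm :: "(real^3) L2 set"
    and P curlh curlh_adj curlc curlc_adj P_adj Q Q_adj :: "(real^3) L2 \<Rightarrow> (real^3) L2"
  assumes domain: "is_domain \<Omega>"
    and partition: "subdomain_partition \<Omega> K \<Omega>k"
    and V0loc: "\<And>k. k \<in> {1..K} \<Longrightarrow> fin_dim_subspace (V0loc k) \<and> V0loc k \<subseteq> H1 (\<Omega>k k)"
    and V1loc: "\<And>k. k \<in> {1..K} \<Longrightarrow> fin_dim_subspace (V1loc k) \<and> V1loc k \<subseteq> Hcurl (\<Omega>k k)"
    and V2loc: "\<And>k. k \<in> {1..K} \<Longrightarrow> fin_dim_subspace (V2loc k) \<and> V2loc k \<subseteq> Hdiv (\<Omega>k k)"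
    and grad_loc: "\<And>k. k \<in> {1..K} \<Longrightarrow> weak_grad (\<Omega>k k) ` V0loc k \<subseteq> V1loc k"
    and curl_loc: "\<And>k. k \<in> {1..K} \<Longrightarrow> weak_curl (\<Omega>k k) ` V1loc k \<subseteq> V2loc k"
    and V0h: "V0h = broken_space \<Omega> K \<Omega>k V0loc"
    and V1h: "V1h = broken_space \<Omega> K \<Omega>k V1loc"
    and V2h: "V2h = broken_space \<Omega> K \<Omega>k V2loc"
    and V0c: "V0c = V0h \<inter> H1_0 \<Omega>"
    and V1c: "V1c = V1h \<inter> Hcurl_0 \<Omega>"
    and V2c: "V2c = V2h \<inter> Hdiv_0 \<Omega>"
    and P: "linear_projection_on V1h V1c P"
    and P_adj: "P_adj = adjoint_on V1h V1h P"
    and Q: "Q = (\<lambda>v. v - P v)"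
    and Q_adj: "Q_adj = adjoint_on V1h V1h Q"
    and curlh: "curlh = (\<lambda>v. weak_curl \<Omega> (P v))"
    and curlh_adj: "curlh_adj = adjoint_on V1h V2h curlh"
    and curlc: "curlc = weak_curl \<Omega>"
    and curlc_adj: "curlc_adj = adjoint_on V1c V2c curlc"
    and harm: "harm = {v \<in> V1c. weak_curl \<Omega> v = 0 \<and> (\<forall>q\<in>V0c. weak_grad \<Omega> q \<bullet> v = 0)}"
  shows
    "(\<forall>lam::real. lam \<noteq> 0 \<longrightarrow> (\<forall>u.
        u \<in> V1h - {0} \<and> curlh_adj (curlh u) = lam *\<^sub>R (P_adj (P u) + Q_adj (Q u))
        \<longleftrightarrow> u \<in> V1c - {0} \<and> curlc_adj (curlc u) = lam *\<^sub>R u))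
     \<and> {u \<in> V1h. curlh_adj (curlh u) = 0 *\<^sub>R (P_adj (P u) + Q_adj (Q u))}
         = {u \<in> V1h. curlh_adj (curlh u) = 0}
     \<and> (\<exists>W. is_orthogonal_direct_sum W (weak_grad \<Omega> ` V0c) harm
          \<and> is_direct_sum {u \<in> V1h. curlh_adj (curlh u) = 0} W (Q ` V1h))"
proof -
  have \<Omega>: "open \<Omega>" using domain by (simp add: is_domain_def)
  have \<Omega>k: "open (\<Omega>k k)" "\<Omega>k k \<subseteq> \<Omega>" if "k \<in> {1..K}" for k
    using partition that by (auto simp: subdomain_partition_def is_domain_def)
  have fV: "fin_dim_subspace V1h"
    unfolding V1h using V1loc by (intro fin_dim_broken_space[OF partition \<Omega>]) auto
  have curl_add: "weak_curl \<Omega> (x + y) = weak_curl \<Omega> x + weak_curl \<Omega> y" if "x \<in> V1c" "y \<in> V1c" for x y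
    using that by (simp add: V1c weak_curl_add[OF \<Omega>])
  have curl_scaleR: "weak_curl \<Omega> (c *\<^sub>R x) = c *\<^sub>R weak_curl \<Omega> x" if "x \<in> V1c" for x c
    using that by (simp add: V1c weak_curl_scaleR[OF \<Omega>])
  \<comment> \<open>Piecewise membership comes from \<open>curl_loc\<close>, as the weak curl
    commutes with restriction to each subdomain; the boundary condition comes from
    \<open>weak_curl_Hcurl_0\<close>. The gradient below is treated likewise.\<close>
  have curl_V2c: "weak_curl \<Omega> x \<in> V2c" if x: "x \<in> V1c" for x
  proof -
    have x': "x \<in> V1h" "x \<in> Hcurl_0 \<Omega>" using x by (simp_all add: V1c)
    have "restrict_L2 (\<Omega>k k) (weak_curl \<Omega> x) \<in> V2loc k" if k: "k \<in> {1..K}" for k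
    proof -
      have "restrict_L2 (\<Omega>k k) x \<in> V1loc k" using x'(1) k by (simp add: V1h broken_space_def)
      then show ?thesis
        using curl_loc[OF k] restrict_weak_curl[OF \<Omega> \<Omega>k[OF k] x'(2)] by auto
    qed
    then show ?thesis
      using weak_curl_Hcurl_0[OF \<Omega> x'(2)] Hdiv_0_subset_L2_on
      by (auto simp: V2c V2h broken_space_def)
  qed
  have grad_V1c: "weak_grad \<Omega> q \<in> V1c" if q: "q \<in> V0c" for q
  proof -
    have q': "q \<in> V0h" "q \<in> H1_0 \<Omega>" using q by (simp_all add: V0c)
    have "restrict_L2 (\<Omega>k k) (weak_grad \<Omega> q) \<in> V1loc k" if k: "k \<in> {1..K}" for k
    proof -
      have "restrict_L2 (\<Omega>k k) q \<in> V0loc k" using q'(1) k by (simp add: V0h broken_space_def)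
      then show ?thesis
        using grad_loc[OF k] restrict_weak_grad[OF \<Omega> \<Omega>k[OF k] q'(2)] by auto
    qed
    then show ?thesis
      using weak_grad_H1_0(1)[OF \<Omega> q'(2)] Hcurl_0_subset_L2_on
      by (auto simp: V1c V1h broken_space_def)
  qed
  have "subspace V0h"
    unfolding V0h using V0loc \<Omega>k by (intro subspace_broken_space \<Omega>) (auto simp: fin_dim_subspace_def)
  then have sU: "subspace (weak_grad \<Omega> ` V0c)"
    unfolding V0c by (intro subspace_weak_grad_image \<Omega> subspace_inter subspace_H1_0) auto
  have U0: "weak_curl \<Omega> x = 0" if "x \<in> weak_grad \<Omega> ` V0c" for x
    using that weak_grad_H1_0(2)[OF \<Omega>] by (auto simp: V0c)
  have ZY: "V2c \<subseteq> V2h" by (simp add: V2c)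
  show ?thesis
  proof (intro conjI allI impI)
    fix lam :: real and u assume lam: "lam \<noteq> 0"
    show "u \<in> V1h - {0} \<and> curlh_adj (curlh u) = lam *\<^sub>R (P_adj (P u) + Q_adj (Q u))
        \<longleftrightarrow> u \<in> V1c - {0} \<and> curlc_adj (curlc u) = lam *\<^sub>R u"
      unfolding curlh_adj curlh P_adj Q_adj Q curlc_adj curlc
      by (rule nonconforming_eigenproblem_iff[OF fV P curl_add curl_scaleR curl_V2c ZY lam])
  next
    show "{u \<in> V1h. curlh_adj (curlh u) = 0 *\<^sub>R (P_adj (P u) + Q_adj (Q u))}
         = {u \<in> V1h. curlh_adj (curlh u) = 0}" by simp
  next
    show "\<exists>W. is_orthogonal_direct_sum W (weak_grad \<Omega> ` V0c) harm
          \<and> is_direct_sum {u \<in> V1h. curlh_adj (curlh u) = 0} W (Q ` V1h)"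
      unfolding curlh_adj curlh Q
      by (rule nonconforming_kernel_decomposition[OF fV P curl_add curl_scaleR _ sU _ U0])
        (use curl_V2c ZY grad_V1c in \<open>auto simp: harm\<close>)
  qed
qed

end
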